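(* Let $\mathcal{G}=(X,*,\mathrm{typ})$ be a connected geometry over $I$ of rank at least three and let $G$ be a group of automorphisms of $\mathcal{G}$. For each $i\in I$ let $w^i_1,\ldots,w^i_{t_i}$ be $G$-orbit representatives of the elements of type $i$ of $\mathcal{G}$ such that (i) $W:=\bigcup_{i\in I}\{w^i_1,\ldots,w^i_{t_i}\}$ is a hall, and (ii) if $V\subseteq W$ is a chamber, the action of $G$ on the pregeometry over $\mathrm{typ}(V)$ consisting of all elements of the $G$-orbits $G.x$, $x\in V$, is incidence-transitive and pennant-transitive. Let $\mathcal{A}(\mathcal{G},G,W)$ be the amalgam of parabolics of $\mathcal{G}$ with respect to $G$ and $W$. The geometry $\mathcal{G}$ is simply connected if and only if the canonical epimorphism $$\mathcal{U}(\mathcal{A}(\mathcal{G},G,W))\to G$$ is an isomorphism.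
   Context: A pregeometry over a set $I$ is a triple $(X,*,\mathrm{typ})$ with a set $X$, a symmetric reflexive incidence relation $*$ on $X$ and a surjection $\mathrm{typ}:X\to I$ such that $x*y$ and $\mathrm{typ}(x)=\mathrm{typ}(y)$ imply $x=y$. Its rank is $|I|$. A flag is a set of pairwise incident elements; a chamber is a flag $F$ with $\mathrm{typ}(F)=I$; a pennant is a flag of cardinality three. A geometry is a pregeometry in which every flag is contained in a chamber. It is connected if the graph $(X,* )$ is connected. A subset $W\subseteq X$ is a hall if $\mathrm{typ}(W)=I$ and every $V\subseteq W$ on which $\mathrm{typ}$ is injective is a flag. An automorphism is a type-preserving permutation of $X$ preserving incidence in both directions; a group of automorphisms of $\mathcal{G}$ is a subgroup of $\mathrm{Aut}(\mathcal{G})$. An action of $G$ by automorphisms is incidence-transitive (resp. pennant-transitive) if any two flags of the same type and of cardinality 2 (resp. 3) are in one $G$-orbit. Amalgam: for a nonempty flag $U\subseteq W$ let $G_U$ be the stabilizer of $U$ in $G$ (fixing every element of $U$). $\mathcal{A}(\mathcal{G},G,W)$ is the family $(G_U)_{\emptyset\ne U\subseteq W\text{ a flag}}$ together with the inclusions $G_{U'}\hookrightarrow G_U$ for $U\subseteq U'$ as identification maps. The universal completion $\mathcal{U}(\mathcal{A})$ is the group with one generator $u_g$ for every element $g$ of the disjoint union of the $G_U$, with relations $u_xu_y=u_z$ whenever $xy=z$ in some $G_U$, and $u_x=u_y$ whenever an identification map sends $x$ to $y$. The canonical map $\mathcal{U}(\mathcal{A})\to G$ sends $u_g$ to $g$.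 Homotopy: a path is a sequence $(x_0,\ldots,x_k)$ of elements with consecutive ones incident; a cycle based at $x$ is a path with $x_0=x_k=x$. Two paths are homotopically equivalent if one is obtained from the other by finitely many insertions or deletions of cycles of length 1, 2 or 3. $\pi_1(\mathcal{G},x)$ is the group of equivalence classes of cycles based at $x$ under concatenation. A connected geometry is simply connected if $\pi_1(\mathcal{G},x)$ is trivial. *)

theory Defs
  imports
    "HOL-Algebra.Group_Action"
    "HOL-Algebra.Bij"
    "HOL-Algebra.Elementary_Groups"
begin

section \<open>Pregeometries and geometries\<close>

record ('x, 'i) pregeom =
  elts :: "'x set"
  inc :: "'x \<Rightarrow> 'x \<Rightarrow> bool"
  tp :: "'x \<Rightarrow> 'i"

definition pregeometry :: "'i set \<Rightarrow> ('x, 'i) pregeom \<Rightarrow> bool" where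
  "pregeometry I \<Gamma> \<longleftrightarrow>
     (\<forall>x \<in> elts \<Gamma>. inc \<Gamma> x x) \<and>
     (\<forall>x \<in> elts \<Gamma>. \<forall>y \<in> elts \<Gamma>. inc \<Gamma> x y \<longrightarrow> inc \<Gamma> y x) \<and>
     tp \<Gamma> ` elts \<Gamma> = I \<and>
     (\<forall>x \<in> elts \<Gamma>. \<forall>y \<in> elts \<Gamma>. inc \<Gamma> x y \<and> tp \<Gamma> x = tp \<Gamma> y \<longrightarrow> x = y)"

definition flag :: "('x, 'i) pregeom \<Rightarrow> 'x set \<Rightarrow> bool" where
  "flag \<Gamma> F \<longleftrightarrow> F \<subseteq> elts \<Gamma> \<and> (\<forall>x \<in> F. \<forall>y \<in> F. inc \<Gamma> x y)"

definition chamber :: "'i set \<Rightarrow> ('x, 'i) pregeom \<Rightarrow> 'x set \<Rightarrow> bool" where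
  "chamber I \<Gamma> F \<longleftrightarrow> flag \<Gamma> F \<and> tp \<Gamma> ` F = I"

definition geometry :: "'i set \<Rightarrow> ('x, 'i) pregeom \<Rightarrow> bool" where
  "geometry I \<Gamma> \<longleftrightarrow>
     pregeometry I \<Gamma> \<and> (\<forall>F. flag \<Gamma> F \<longrightarrow> (\<exists>C. chamber I \<Gamma> C \<and> F \<subseteq> C))"

definition hall :: "'i set \<Rightarrow> ('x, 'i) pregeom \<Rightarrow> 'x set \<Rightarrow> bool" where
  "hall I \<Gamma> W \<longleftrightarrow>
     W \<subseteq> elts \<Gamma> \<and> tp \<Gamma> ` W = I \<and> (\<forall>V \<subseteq> W. inj_on (tp \<Gamma>) V \<longrightarrow> flag \<Gamma> V)"


section \<open>Paths, homotopy and the fundamental group\<close>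

definition path :: "('x, 'i) pregeom \<Rightarrow> 'x list \<Rightarrow> bool" where
  "path \<Gamma> p \<longleftrightarrow> p \<noteq> [] \<and> set p \<subseteq> elts \<Gamma> \<and> successively (inc \<Gamma>) p"

definition connected_geom :: "('x, 'i) pregeom \<Rightarrow> bool" where
  "connected_geom \<Gamma> \<longleftrightarrow>
     (\<forall>x \<in> elts \<Gamma>. \<forall>y \<in> elts \<Gamma>. \<exists>p. path \<Gamma> p \<and> hd p = x \<and> last p = y)"

definition cycle_at :: "('x, 'i) pregeom \<Rightarrow> 'x \<Rightarrow> 'x list \<Rightarrow> bool" where
  "cycle_at \<Gamma> x p \<longleftrightarrow> path \<Gamma> p \<and> hd p = x \<and> last p = x"

text \<open>
  The length of the path \<open>(x\<^sub>0, \<dots>, x\<^sub>k)\<close> is \<open>k\<close>, one less than the length of the list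
  representing it.
\<close>
definition insert_cycle :: "('x, 'i) pregeom \<Rightarrow> 'x list \<Rightarrow> 'x list \<Rightarrow> bool" where
  "insert_cycle \<Gamma> p q \<longleftrightarrow> path \<Gamma> p \<and> path \<Gamma> q \<and>
     (\<exists>a x b c. p = a @ [x] @ b \<and> q = a @ c @ b \<and>
        cycle_at \<Gamma> x c \<and> length c - 1 \<in> {1, 2, 3})"

definition homotopic :: "('x, 'i) pregeom \<Rightarrow> 'x list \<Rightarrow> 'x list \<Rightarrow> bool" where
  "homotopic \<Gamma> = equivclp (insert_cycle \<Gamma>)"

definition homotopy_class :: "('x, 'i) pregeom \<Rightarrow> 'x list \<Rightarrow> 'x list set" where
  "homotopy_class \<Gamma> p = {q. homotopic \<Gamma> p q}"

definition fundamental_group :: "('x, 'i) pregeom \<Rightarrow> 'x \<Rightarrow> 'x list set monoid" where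
  "fundamental_group \<Gamma> x =
     \<lparr>carrier = homotopy_class \<Gamma> ` {p. cycle_at \<Gamma> x p},
      mult = (\<lambda>A B. \<Union>p \<in> A. \<Union>q \<in> B. homotopy_class \<Gamma> (p @ tl q)),
      one = homotopy_class \<Gamma> [x]\<rparr>"

definition simply_connected :: "('x, 'i) pregeom \<Rightarrow> bool" where
  "simply_connected \<Gamma> \<longleftrightarrow>
     connected_geom \<Gamma> \<and> (\<forall>x \<in> elts \<Gamma>. trivial_group (fundamental_group \<Gamma> x))"


section \<open>Groups of automorphisms\<close>

definition Aut :: "('x, 'i) pregeom \<Rightarrow> ('x \<Rightarrow> 'x) monoid" where
  "Aut \<Gamma> = BijGroup (elts \<Gamma>)
     \<lparr>carrier := {g \<in> Bij (elts \<Gamma>).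
        (\<forall>x \<in> elts \<Gamma>. tp \<Gamma> (g x) = tp \<Gamma> x) \<and>
        (\<forall>x \<in> elts \<Gamma>. \<forall>y \<in> elts \<Gamma>. inc \<Gamma> (g x) (g y) \<longleftrightarrow> inc \<Gamma> x y)}\<rparr>"

definition flag_transitive :: "nat \<Rightarrow> ('x \<Rightarrow> 'x) monoid \<Rightarrow> ('x, 'i) pregeom \<Rightarrow> bool" where
  "flag_transitive n G \<Gamma> \<longleftrightarrow>
     (\<forall>F F'. flag \<Gamma> F \<and> flag \<Gamma> F' \<and> card F = n \<and> card F' = n \<and> tp \<Gamma> ` F = tp \<Gamma> ` F' \<longrightarrow>
        (\<exists>g \<in> carrier G. g ` F = F'))"

abbreviation incidence_transitive :: "('x \<Rightarrow> 'x) monoid \<Rightarrow> ('x, 'i) pregeom \<Rightarrow> bool" where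
  "incidence_transitive \<equiv> flag_transitive 2"

abbreviation pennant_transitive :: "('x \<Rightarrow> 'x) monoid \<Rightarrow> ('x, 'i) pregeom \<Rightarrow> bool" where
  "pennant_transitive \<equiv> flag_transitive 3"

text \<open>The pregeometry of all elements of the orbits meeting \<open>V\<close>; its type set is \<open>tp \<Gamma> ` V\<close>.\<close>
definition orbit_pregeometry ::
    "('x, 'i) pregeom \<Rightarrow> ('x \<Rightarrow> 'x) monoid \<Rightarrow> 'x set \<Rightarrow> ('x, 'i) pregeom" where
  "orbit_pregeometry \<Gamma> G V = \<Gamma>\<lparr>elts := (\<Union>x \<in> V. orbit G (\<lambda>g. g) x)\<rparr>"

definition orbit_representatives ::
    "('x, 'i) pregeom \<Rightarrow> ('x \<Rightarrow> 'x) monoid \<Rightarrow> 'i \<Rightarrow> nat \<Rightarrow> (nat \<Rightarrow> 'x) \<Rightarrow> bool" where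
  "orbit_representatives \<Gamma> G i t w \<longleftrightarrow>
     (\<forall>k \<in> {1..t}. w k \<in> elts \<Gamma> \<and> tp \<Gamma> (w k) = i) \<and>
     (\<forall>x \<in> elts \<Gamma>. tp \<Gamma> x = i \<longrightarrow> (\<exists>!k. k \<in> {1..t} \<and> x \<in> orbit G (\<lambda>g. g) (w k)))"


section \<open>Group presentations\<close>

text \<open>
  A word is a list of letters; the letter \<open>(s, True)\<close> is the generator \<open>s\<close> and \<open>(s, False)\<close> its
  formal inverse.  A relation is a pair of words that are to become equal.
\<close>
type_synonym 's word = "('s \<times> bool) list"

inductive pres_eq :: "'s set \<Rightarrow> ('s word \<times> 's word) set \<Rightarrow> 's word \<Rightarrow> 's word \<Rightarrow> bool"
  for S R where
  rel: "(u, v) \<in> R \<Longrightarrow> u \<in> lists (S \<times> UNIV) \<Longrightarrow> v \<in> lists (S \<times> UNIV) \<Longrightarrow> pres_eq S R u v"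
| cancel: "s \<in> S \<Longrightarrow> pres_eq S R [(s, b), (s, \<not> b)] []"
| refl: "u \<in> lists (S \<times> UNIV) \<Longrightarrow> pres_eq S R u u"
| sym: "pres_eq S R u v \<Longrightarrow> pres_eq S R v u"
| trans: "pres_eq S R u v \<Longrightarrow> pres_eq S R v w \<Longrightarrow> pres_eq S R u w"
| cong: "pres_eq S R u u' \<Longrightarrow> pres_eq S R v v' \<Longrightarrow> pres_eq S R (u @ v) (u' @ v')"

definition pres_class :: "'s set \<Rightarrow> ('s word \<times> 's word) set \<Rightarrow> 's word \<Rightarrow> 's word set" where
  "pres_class S R u = {v. pres_eq S R u v}"

definition presented_group :: "'s set \<Rightarrow> ('s word \<times> 's word) set \<Rightarrow> 's word set monoid" where
  "presented_group S R =
     \<lparr>carrier = pres_class S R ` lists (S \<times> UNIV),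
      mult = (\<lambda>A B. \<Union>u \<in> A. \<Union>v \<in> B. pres_class S R (u @ v)),
      one = pres_class S R []\<rparr>"

fun word_eval :: "('a, 'b) monoid_scheme \<Rightarrow> ('s \<Rightarrow> 'a) \<Rightarrow> 's word \<Rightarrow> 'a" where
  "word_eval G f [] = \<one>\<^bsub>G\<^esub>"
| "word_eval G f ((s, b) # u) =
     (if b then f s else inv\<^bsub>G\<^esub> (f s)) \<otimes>\<^bsub>G\<^esub> word_eval G f u"

text \<open>The map out of a presented group determined by the images \<open>f\<close> of the generators.\<close>
definition induced_map :: "('a, 'b) monoid_scheme \<Rightarrow> ('s \<Rightarrow> 'a) \<Rightarrow> 's word set \<Rightarrow> 'a" where
  "induced_map G f C = (THE h. \<forall>u \<in> C. word_eval G f u = h)"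


section \<open>Amalgams and their universal completions\<close>

text \<open>
  A triple \<open>(j, \<phi>, k)\<close> in \<open>idents\<close> is an identification map \<open>\<phi>\<close> from the group of index \<open>j\<close>
  to the group of index \<open>k\<close>.
\<close>
record ('j, 'a) amalgam =
  indices :: "'j set"
  grp :: "'j \<Rightarrow> 'a monoid"
  idents :: "('j \<times> ('a \<Rightarrow> 'a) \<times> 'j) set"

definition amalgam_gens :: "('j, 'a) amalgam \<Rightarrow> ('j \<times> 'a) set" where
  "amalgam_gens A = Sigma (indices A) (\<lambda>j. carrier (grp A j))"

definition amalgam_rels :: "('j, 'a) amalgam \<Rightarrow> (('j \<times> 'a) word \<times> ('j \<times> 'a) word) set" where
  "amalgam_rels A =
     {([((j, x), True), ((j, y), True)], [((j, x \<otimes>\<^bsub>grp A j\<^esub> y), True)]) | j x y.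
        j \<in> indices A \<and> x \<in> carrier (grp A j) \<and> y \<in> carrier (grp A j)} \<union>
     {([((j, x), True)], [((k, \<phi> x), True)]) | j \<phi> k x.
        (j, \<phi>, k) \<in> idents A \<and> x \<in> carrier (grp A j)}"

definition universal_completion :: "('j, 'a) amalgam \<Rightarrow> ('j \<times> 'a) word set monoid" where
  "universal_completion A = presented_group (amalgam_gens A) (amalgam_rels A)"

definition pointwise_stabilizer :: "('x \<Rightarrow> 'x) monoid \<Rightarrow> 'x set \<Rightarrow> ('x \<Rightarrow> 'x) set" where
  "pointwise_stabilizer G U = {g \<in> carrier G. \<forall>u \<in> U. g u = u}"

definition parabolic_amalgam ::
    "('x, 'i) pregeom \<Rightarrow> ('x \<Rightarrow> 'x) monoid \<Rightarrow> 'x set \<Rightarrow> ('x set, 'x \<Rightarrow> 'x) amalgam" where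
  "parabolic_amalgam \<Gamma> G W =
     (let J = {U. U \<noteq> {} \<and> U \<subseteq> W \<and> flag \<Gamma> U}
      in \<lparr>indices = J,
          grp = (\<lambda>U. G\<lparr>carrier := pointwise_stabilizer G U\<rparr>),
          idents = {(U', \<lambda>g. g, U) | U U'. U \<in> J \<and> U' \<in> J \<and> U \<subseteq> U'}\<rparr>)"

text \<open>A generator is an index paired with an element of the group of that index.\<close>
definition canonical_map :: "('x \<Rightarrow> 'x) monoid \<Rightarrow> ('j \<times> ('x \<Rightarrow> 'x)) word set \<Rightarrow> ('x \<Rightarrow> 'x)" where
  "canonical_map G = induced_map G snd"


section \<open>Well-definedness\<close>

lemma UN_UN_eqI:
  "(\<And>a b. a \<in> A \<Longrightarrow> b \<in> B \<Longrightarrow> f a b = C) \<Longrightarrow> a \<in> A \<Longrightarrow> b \<in> B \<Longrightarrow>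
   (\<Union>a \<in> A. \<Union>b \<in> B. f a b) = C"
  by blast

lemma pres_eq_words:
  "pres_eq S R u v \<Longrightarrow> u \<in> lists (S \<times> UNIV) \<and> v \<in> lists (S \<times> UNIV)"
  by (induction rule: pres_eq.induct) auto

lemma pres_class_eq: "pres_eq S R u v \<Longrightarrow> pres_class S R u = pres_class S R v"
  unfolding pres_class_def by (blast intro: pres_eq.sym pres_eq.trans)

lemma mult_pres_class:
  assumes "u \<in> lists (S \<times> UNIV)" "v \<in> lists (S \<times> UNIV)"
  shows "pres_class S R u \<otimes>\<^bsub>presented_group S R\<^esub> pres_class S R v = pres_class S R (u @ v)"
proof -
  have "pres_class S R (u' @ v') = pres_class S R (u @ v)"
    if "u' \<in> pres_class S R u" "v' \<in> pres_class S R v" for u' v'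
    using that by (metis mem_Collect_eq pres_class_def pres_class_eq pres_eq.cong)
  moreover have "u \<in> pres_class S R u" "v \<in> pres_class S R v"
    using assms by (auto simp: pres_class_def intro: pres_eq.refl)
  ultimately have "(\<Union>u' \<in> pres_class S R u. \<Union>v' \<in> pres_class S R v. pres_class S R (u' @ v')) =
      pres_class S R (u @ v)"
    by (intro UN_UN_eqI)
  then show ?thesis
    by (simp add: presented_group_def)
qed

lemma pres_eq_inverse:
  assumes "u \<in> lists (S \<times> UNIV)"
  shows "pres_eq S R (rev (map (\<lambda>(s, b). (s, \<not> b)) u) @ u) []"
  using assms
proof (induction u)
  case (Cons a u)
  obtain s b where a: "a = (s, b)" by force
  let ?v = "rev (map (\<lambda>(s, b). (s, \<not> b)) u)"
  have u: "u \<in> lists (S \<times> UNIV)" and v: "?v \<in> lists (S \<times> UNIV)"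
    using Cons by (auto simp: in_lists_conv_set)
  have "pres_eq S R [(s, \<not> b), (s, b)] []"
    using pres_eq.cancel[of s S R "\<not> b"] Cons a by auto
  then have "pres_eq S R (?v @ [(s, \<not> b), (s, b)] @ u) (?v @ [] @ u)"
    using u v by (intro pres_eq.cong pres_eq.refl)
  then show ?case
    using Cons a by (auto intro: pres_eq.trans)
qed (auto intro: pres_eq.refl)

lemma group_presented_group: "group (presented_group S R)"
proof (rule groupI)
  fix x assume "x \<in> carrier (presented_group S R)"
  then obtain u where u: "u \<in> lists (S \<times> UNIV)" "x = pres_class S R u"
    by (auto simp: presented_group_def)
  let ?v = "rev (map (\<lambda>(s, b). (s, \<not> b)) u)"
  have "?v \<in> lists (S \<times> UNIV)"
    using u by (auto simp: in_lists_conv_set)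
  with u pres_eq_inverse[OF u(1)]
  have "pres_class S R ?v \<otimes>\<^bsub>presented_group S R\<^esub> x = \<one>\<^bsub>presented_group S R\<^esub>"
    by (metis mult_pres_class monoid.select_convs(2) pres_class_eq presented_group_def)
  then show "\<exists>y\<in>carrier (presented_group S R). y \<otimes>\<^bsub>presented_group S R\<^esub> x = \<one>\<^bsub>presented_group S R\<^esub>"
    using \<open>?v \<in> _\<close> by (auto simp: presented_group_def)
next
  fix x assume "x \<in> carrier (presented_group S R)"
  then obtain u where u: "u \<in> lists (S \<times> UNIV)" "x = pres_class S R u"
    by (auto simp: presented_group_def)
  then show "\<one>\<^bsub>presented_group S R\<^esub> \<otimes>\<^bsub>presented_group S R\<^esub> x = x"
    using mult_pres_class[of "[]" S u R] by (simp add: presented_group_def)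
next
  fix x y assume "x \<in> carrier (presented_group S R)" "y \<in> carrier (presented_group S R)"
  then obtain u v where "u \<in> lists (S \<times> UNIV)" "x = pres_class S R u"
    "v \<in> lists (S \<times> UNIV)" "y = pres_class S R v"
    by (auto simp: presented_group_def)
  then show "x \<otimes>\<^bsub>presented_group S R\<^esub> y \<in> carrier (presented_group S R)"
    by (simp add: mult_pres_class) (auto simp: presented_group_def)
next
  fix x y z assume "x \<in> carrier (presented_group S R)" "y \<in> carrier (presented_group S R)"
    "z \<in> carrier (presented_group S R)"
  then obtain u v w where uvw: "u \<in> lists (S \<times> UNIV)" "v \<in> lists (S \<times> UNIV)"
      "w \<in> lists (S \<times> UNIV)"
    and eqs: "x = pres_class S R u" "y = pres_class S R v" "z = pres_class S R w"
    by (auto simp: presented_group_def)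
  have "u @ v \<in> lists (S \<times> UNIV)" "v @ w \<in> lists (S \<times> UNIV)"
    using uvw by auto
  with uvw show "x \<otimes>\<^bsub>presented_group S R\<^esub> y \<otimes>\<^bsub>presented_group S R\<^esub> z =
      x \<otimes>\<^bsub>presented_group S R\<^esub> (y \<otimes>\<^bsub>presented_group S R\<^esub> z)"
    unfolding eqs by (simp only: mult_pres_class append_assoc)
qed (auto simp: presented_group_def)

context group
begin

lemma word_eval_closed:
  "f \<in> S \<rightarrow> carrier G \<Longrightarrow> u \<in> lists (S \<times> UNIV) \<Longrightarrow> word_eval G f u \<in> carrier G"
  by (induction u) (auto simp: Pi_iff)

lemma word_eval_append:
  "f \<in> S \<rightarrow> carrier G \<Longrightarrow> u \<in> lists (S \<times> UNIV) \<Longrightarrow> v \<in> lists (S \<times> UNIV) \<Longrightarrow>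
   word_eval G f (u @ v) = word_eval G f u \<otimes> word_eval G f v"
proof (induction u)
  case Nil
  then show ?case using word_eval_closed[of f S v] by simp
next
  case (Cons a u)
  obtain s b where a: "a = (s, b)" by force
  have "(if b then f s else inv (f s)) \<in> carrier G"
    using Cons.prems a by auto
  then show ?case
    using Cons word_eval_closed[OF Cons.prems(1)] a by (auto simp: m_assoc )
qed

lemma word_eval_pres_eq:
  assumes "f \<in> S \<rightarrow> carrier G"
    and "\<And>u v. (u, v) \<in> R \<Longrightarrow> u \<in> lists (S \<times> UNIV) \<Longrightarrow> v \<in> lists (S \<times> UNIV) \<Longrightarrow>
           word_eval G f u = word_eval G f v"
    and "pres_eq S R u v"
  shows "word_eval G f u = word_eval G f v"
  using assms(3)
proof (induction rule: pres_eq.induct)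
  case (cancel s b)
  then have "f s \<in> carrier G" using assms(1) by auto
  then show ?case by auto
next
  case (cong u u' v v')
  then show ?case
    using pres_eq_words[OF cong.hyps(1)] pres_eq_words[OF cong.hyps(2)]
    by (simp add: word_eval_append[OF assms(1)])
qed (use assms(2) in auto)

lemma induced_map_pres_class:
  assumes "f \<in> S \<rightarrow> carrier G"
    and "\<And>u v. (u, v) \<in> R \<Longrightarrow> u \<in> lists (S \<times> UNIV) \<Longrightarrow> v \<in> lists (S \<times> UNIV) \<Longrightarrow>
           word_eval G f u = word_eval G f v"
    and "u \<in> lists (S \<times> UNIV)"
  shows "induced_map G f (pres_class S R u) = word_eval G f u"
proof -
  have "u \<in> pres_class S R u"
    using assms(3) by (auto simp: pres_class_def intro: pres_eq.refl)
  moreover have "word_eval G f v = word_eval G f u" if "v \<in> pres_class S R u" for v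
    using word_eval_pres_eq[OF assms(1,2)] that by (metis mem_Collect_eq pres_class_def)
  ultimately show ?thesis
    unfolding induced_map_def by (intro the_equality) (blast, metis)
qed

lemma induced_map_hom:
  assumes "f \<in> S \<rightarrow> carrier G"
    and "\<And>u v. (u, v) \<in> R \<Longrightarrow> u \<in> lists (S \<times> UNIV) \<Longrightarrow> v \<in> lists (S \<times> UNIV) \<Longrightarrow>
           word_eval G f u = word_eval G f v"
  shows "induced_map G f \<in> hom (presented_group S R) G"
proof -
  have val: "induced_map G f (pres_class S R u) = word_eval G f u" if "u \<in> lists (S \<times> UNIV)" for u
    using assms that by (rule induced_map_pres_class)
  show ?thesis
proof (rule homI)
  fix x assume "x \<in> carrier (presented_group S R)"
  then obtain u where "u \<in> lists (S \<times> UNIV)" "x = pres_class S R u"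
    by (auto simp: presented_group_def)
  then show "induced_map G f x \<in> carrier G"
    by (simp only: val word_eval_closed[OF assms(1)])
next
  fix x y assume "x \<in> carrier (presented_group S R)" "y \<in> carrier (presented_group S R)"
  then obtain u v where uv: "u \<in> lists (S \<times> UNIV)" "x = pres_class S R u"
    "v \<in> lists (S \<times> UNIV)" "y = pres_class S R v"
    by (auto simp: presented_group_def)
  moreover from uv have "u @ v \<in> lists (S \<times> UNIV)" by auto
  ultimately show "induced_map G f (x \<otimes>\<^bsub>presented_group S R\<^esub> y) = induced_map G f x \<otimes> induced_map G f y"
    by (simp only: mult_pres_class val word_eval_append[OF assms(1)])
qed
qed

end

lemma canonical_map_universal_completion:
  assumes "group G"
  shows "canonical_map G \<in> hom (universal_completion (parabolic_amalgam \<Gamma> G W)) G"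
    and "(U, g) \<in> amalgam_gens (parabolic_amalgam \<Gamma> G W) \<Longrightarrow>
      canonical_map G (pres_class (amalgam_gens (parabolic_amalgam \<Gamma> G W))
        (amalgam_rels (parabolic_amalgam \<Gamma> G W)) [((U, g), True)]) = g"
proof -
  interpret group G by fact
  let ?S = "amalgam_gens (parabolic_amalgam \<Gamma> G W)"
  let ?R = "amalgam_rels (parabolic_amalgam \<Gamma> G W)"
  have 1: "snd \<in> ?S \<rightarrow> carrier G"
    by (auto simp: amalgam_gens_def parabolic_amalgam_def Let_def pointwise_stabilizer_def)
  have 2: "word_eval G snd u = word_eval G snd v" if "(u, v) \<in> ?R" for u v
    using that
    by (auto simp: amalgam_rels_def parabolic_amalgam_def Let_def pointwise_stabilizer_def)
  show "canonical_map G \<in> hom (universal_completion (parabolic_amalgam \<Gamma> G W)) G"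
    unfolding canonical_map_def universal_completion_def
    using 1 2 by (intro induced_map_hom) auto
  assume "(U, g) \<in> ?S"
  then show "canonical_map G (pres_class ?S ?R [((U, g), True)]) = g"
    unfolding canonical_map_def
    using 1 2 by (subst induced_map_pres_class) (auto simp: Pi_iff)
qed

lemma group_Aut: "group (Aut \<Gamma>)"
proof -
  let ?A = "carrier (Aut \<Gamma>)"
  have "subgroup ?A (BijGroup (elts \<Gamma>))"
  proof (rule group.subgroupI[OF group_BijGroup])
    show "?A \<subseteq> carrier (BijGroup (elts \<Gamma>))" by (auto simp: Aut_def BijGroup_def)
    have "(\<lambda>x\<in>elts \<Gamma>. x) \<in> ?A" by (auto simp: Aut_def id_Bij)
    then show "?A \<noteq> {}" by blast
  next
    fix g assume g: "g \<in> ?A"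
    then have gB: "g \<in> Bij (elts \<Gamma>)" by (auto simp: Aut_def)
    then have b: "bij_betw g (elts \<Gamma>) (elts \<Gamma>)" by (auto simp: Bij_def)
    let ?h = "inv_into (elts \<Gamma>) g"
    have h: "?h x \<in> elts \<Gamma>" "g (?h x) = x" if "x \<in> elts \<Gamma>" for x
      using b that by (auto simp: bij_betw_def inv_into_into f_inv_into_f)
    have "tp \<Gamma> (?h x) = tp \<Gamma> x" if "x \<in> elts \<Gamma>" for x
      using g h[OF that] by (auto simp: Aut_def)
    moreover have "inc \<Gamma> (?h x) (?h y) \<longleftrightarrow> inc \<Gamma> x y" if "x \<in> elts \<Gamma>" "y \<in> elts \<Gamma>" for x y
      using g h[OF that(1)] h[OF that(2)] by (simp add: Aut_def) metis
    moreover have "restrict ?h (elts \<Gamma>) \<in> Bij (elts \<Gamma>)"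
      using gB by (rule restrict_inv_into_Bij)
    ultimately have "restrict ?h (elts \<Gamma>) \<in> ?A"
      by (auto simp: Aut_def)
    then show "inv\<^bsub>BijGroup (elts \<Gamma>)\<^esub> g \<in> ?A"
      using gB by (simp add: inv_BijGroup)
  next
    fix g h assume gh: "g \<in> ?A" "h \<in> ?A"
    then have B: "g \<in> Bij (elts \<Gamma>)" "h \<in> Bij (elts \<Gamma>)" by (auto simp: Aut_def)
    have "h x \<in> elts \<Gamma>" if "x \<in> elts \<Gamma>" for x
      using B(2) that by (auto simp: Bij_def bij_betw_def)
    then have "compose (elts \<Gamma>) g h \<in> ?A"
      using gh B by (auto simp: Aut_def compose_Bij compose_eq)
    then show "g \<otimes>\<^bsub>BijGroup (elts \<Gamma>)\<^esub> h \<in> ?A"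
      using B by (simp add: BijGroup_def)
  qed
  then have "group (BijGroup (elts \<Gamma>)\<lparr>carrier := ?A\<rparr>)"
    by (rule subgroup.subgroup_is_group[OF _ group_BijGroup])
  then show ?thesis by (simp add: Aut_def)
qed

lemma homotopic_refl: "homotopic \<Gamma> p p"
  by (simp add: homotopic_def)
lemma homotopic_sym: "homotopic \<Gamma> p q \<Longrightarrow> homotopic \<Gamma> q p"
  by (simp add: homotopic_def equivclp_sym)
lemma homotopic_trans: "homotopic \<Gamma> p q \<Longrightarrow> homotopic \<Gamma> q r \<Longrightarrow> homotopic \<Gamma> p r"
  unfolding homotopic_def by (rule equivclp_trans)

lemma homotopy_class_eq: "homotopic \<Gamma> p q \<Longrightarrow> homotopy_class \<Gamma> p = homotopy_class \<Gamma> q"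
  unfolding homotopy_class_def by (blast intro: homotopic_sym homotopic_trans)

lemma insert_cycle_ends:
  assumes "insert_cycle \<Gamma> p q"
  shows "hd p = hd q \<and> last p = last q \<and> path \<Gamma> p \<and> path \<Gamma> q"
proof -
  from assms obtain a x b c where *: "p = a @ [x] @ b" "q = a @ c @ b" "cycle_at \<Gamma> x c" "path \<Gamma> p" "path \<Gamma> q"
    unfolding insert_cycle_def by blast
  then have "c \<noteq> []" "hd c = x" "last c = x" by (auto simp: cycle_at_def path_def)
  then show ?thesis using * by (cases a; cases "b = []") (auto simp: hd_append)
qed

lemma homotopic_cycle:
  assumes "homotopic \<Gamma> p q" "cycle_at \<Gamma> x p" shows "cycle_at \<Gamma> x q"
  using assms unfolding homotopic_def
  by (induction rule: equivclp_induct) (auto simp: cycle_at_def dest: insert_cycle_ends)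

lemma path_comp:
  assumes "path \<Gamma> p" "path \<Gamma> q" "last p = hd q"
  shows "path \<Gamma> (p @ tl q)" "hd (p @ tl q) = hd p" "last (p @ tl q) = last q"
  using assms
  by (cases q; cases "tl q = []"; auto simp: path_def successively_append_iff successively_Cons)+

lemma homotopic_comp_left:
  assumes "homotopic \<Gamma> p p'" "cycle_at \<Gamma> x p" "cycle_at \<Gamma> x q"
  shows "homotopic \<Gamma> (p @ tl q) (p' @ tl q)"
proof -
  have step: "insert_cycle \<Gamma> (r @ tl q) (r' @ tl q)" if i: "insert_cycle \<Gamma> r r'" and c: "cycle_at \<Gamma> x r" for r r'
  proof -
    have "path \<Gamma> (r @ tl q)" "path \<Gamma> (r' @ tl q)"
      using insert_cycle_ends[OF i] c assms(3) by (auto simp: cycle_at_def intro!: path_comp)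
    moreover obtain a y b cc where "r = a @ [y] @ b" "r' = a @ cc @ b" "cycle_at \<Gamma> y cc" "length cc - 1 \<in> {1,2,3}"
      using i unfolding insert_cycle_def by blast
    ultimately show ?thesis unfolding insert_cycle_def
      by (intro conjI exI[of _ a] exI[of _ y] exI[of _ "b @ tl q"] exI[of _ cc]) auto
  qed
  from assms(1) have "cycle_at \<Gamma> x p' \<and> homotopic \<Gamma> (p @ tl q) (p' @ tl q)"
    unfolding homotopic_def
  proof (induction rule: equivclp_induct)
    case base then show ?case using assms by (simp)
  next
    case (step r s)
    then have "cycle_at \<Gamma> x s" by (auto simp: cycle_at_def dest: insert_cycle_ends)
    then show ?case using step \<open>\<And>r r'. _ \<Longrightarrow> _ \<Longrightarrow> insert_cycle \<Gamma> (r @ tl q) (r' @ tl q)\<close>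
      by (metis equivclp_sym equivclp_trans r_into_equivclp)
  qed
  then show ?thesis by simp
qed

lemma homotopic_comp_right:
  assumes "homotopic \<Gamma> q q'" "cycle_at \<Gamma> x p" "cycle_at \<Gamma> x q"
  shows "homotopic \<Gamma> (p @ tl q) (p @ tl q')"
proof -
  have bl: "p @ tl r = butlast p @ r" if "cycle_at \<Gamma> x r" for r
    using that assms(2) unfolding cycle_at_def path_def
    by (metis append.assoc append_Cons append_Nil append_butlast_last_id list.collapse)
  have st: "insert_cycle \<Gamma> (p @ tl r) (p @ tl r')" if i: "insert_cycle \<Gamma> r r'" and c: "cycle_at \<Gamma> x r" for r r'
  proof -
    have c': "cycle_at \<Gamma> x r'" using c insert_cycle_ends[OF i] by (auto simp: cycle_at_def)
    have "path \<Gamma> (p @ tl r)" "path \<Gamma> (p @ tl r')"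
      using c c' assms(2) by (auto simp: cycle_at_def intro!: path_comp)
    moreover obtain a y b cc where "r = a @ [y] @ b" "r' = a @ cc @ b" "cycle_at \<Gamma> y cc" "length cc - 1 \<in> {1,2,3}"
      using i unfolding insert_cycle_def by blast
    ultimately show ?thesis unfolding insert_cycle_def bl[OF c] bl[OF c']
      by (intro conjI exI[of _ "butlast p @ a"] exI[of _ y] exI[of _ b] exI[of _ cc]) auto
  qed
  from assms(1) have "cycle_at \<Gamma> x q' \<and> homotopic \<Gamma> (p @ tl q) (p @ tl q')"
    unfolding homotopic_def
  proof (induction rule: equivclp_induct)
    case base then show ?case using assms by (simp)
  next
    case (step r s)
    then have "cycle_at \<Gamma> x s" by (auto simp: cycle_at_def dest: insert_cycle_ends)
    then show ?case using step st
      by (metis equivclp_sym equivclp_trans r_into_equivclp)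
  qed
  then show ?thesis by simp
qed

lemma mult_homotopy_class:
  assumes "cycle_at \<Gamma> x p" "cycle_at \<Gamma> x q"
  shows "homotopy_class \<Gamma> p \<otimes>\<^bsub>fundamental_group \<Gamma> x\<^esub> homotopy_class \<Gamma> q = homotopy_class \<Gamma> (p @ tl q)"
proof -
  have "homotopy_class \<Gamma> (p' @ tl q') = homotopy_class \<Gamma> (p @ tl q)"
    if "p' \<in> homotopy_class \<Gamma> p" "q' \<in> homotopy_class \<Gamma> q" for p' q'
  proof -
    have h: "homotopic \<Gamma> p p'" "homotopic \<Gamma> q q'" using that by (auto simp: homotopy_class_def)
    then have "homotopic \<Gamma> (p @ tl q) (p' @ tl q')"
      using homotopic_comp_left[OF h(1) assms] homotopic_comp_right[OF h(2) homotopic_cycle[OF h(1) assms(1)] assms(2)]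
        homotopic_trans by blast
    then show ?thesis by (metis homotopy_class_eq)
  qed
  moreover have "p \<in> homotopy_class \<Gamma> p" "q \<in> homotopy_class \<Gamma> q"
    by (auto simp: homotopy_class_def homotopic_refl)
  ultimately have "(\<Union>p' \<in> homotopy_class \<Gamma> p. \<Union>q' \<in> homotopy_class \<Gamma> q. homotopy_class \<Gamma> (p' @ tl q')) =
      homotopy_class \<Gamma> (p @ tl q)"
    by (intro UN_UN_eqI)
  then show ?thesis
    by (simp add: fundamental_group_def)
qed

lemma path_rev:
  assumes "\<And>x y. x \<in> elts \<Gamma> \<Longrightarrow> y \<in> elts \<Gamma> \<Longrightarrow> inc \<Gamma> x y \<Longrightarrow> inc \<Gamma> y x" "path \<Gamma> p"
  shows "path \<Gamma> (rev p)"
proof -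
  have "successively (\<lambda>x y. inc \<Gamma> y x) p"
    using assms(2) unfolding path_def
    by (auto intro: successively_mono[where P = "inc \<Gamma>"] assms(1))
  then show ?thesis using assms(2) by (auto simp: path_def)
qed

lemma rev_homotopic:
  assumes S: "\<And>x y. x \<in> elts \<Gamma> \<Longrightarrow> y \<in> elts \<Gamma> \<Longrightarrow> inc \<Gamma> x y \<Longrightarrow> inc \<Gamma> y x"
  shows "path \<Gamma> p \<Longrightarrow> homotopic \<Gamma> (rev p @ tl p) [last p]"
proof (induction p)
  case Nil then show ?case by (simp add: path_def)
next
  case (Cons a p)
  show ?case
  proof (cases p)
    case Nil then show ?thesis by (simp add: homotopic_refl)
  next
    case (Cons b p')
    have P: "path \<Gamma> p" using Cons.prems Cons by (auto simp: path_def)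
    have ab: "a \<in> elts \<Gamma>" "b \<in> elts \<Gamma>" "inc \<Gamma> a b" using Cons.prems Cons by (auto simp: path_def)
    then have "cycle_at \<Gamma> b [b,a,b]" using S by (auto simp: cycle_at_def path_def)
    moreover have "path \<Gamma> (rev p @ tl p)"
      by (rule path_comp) (use P path_rev[OF S P] in \<open>auto simp: path_def last_rev\<close>)
    moreover have "path \<Gamma> (rev (a # p) @ tl (a # p))"
      by (rule path_comp) (use Cons.prems path_rev[OF S Cons.prems] in \<open>auto simp: path_def last_rev\<close>)
    ultimately have "insert_cycle \<Gamma> (rev p @ tl p) (rev (a # p) @ tl (a # p))"
      unfolding insert_cycle_def
      by (intro conjI exI[of _ "rev p'"] exI[of _ b] exI[of _ p'] exI[of _ "[b,a,b]"]) (auto simp: Cons)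
    then show ?thesis using Cons.IH[OF P] Cons
      by (metis equivclp_sym homotopic_def homotopic_trans last_ConsR list.distinct(1) r_into_equivclp)
  qed
qed

lemma group_fundamental_group:
  assumes "pregeometry I \<Gamma>" "x \<in> elts \<Gamma>"
  shows "group (fundamental_group \<Gamma> x)"
proof -
  have c1: "cycle_at \<Gamma> x [x]" using assms by (auto simp: cycle_at_def path_def)
  have car: "y \<in> carrier (fundamental_group \<Gamma> x) \<longleftrightarrow> (\<exists>p. cycle_at \<Gamma> x p \<and> y = homotopy_class \<Gamma> p)" for y
    by (auto simp: fundamental_group_def)
  have one: "\<one>\<^bsub>fundamental_group \<Gamma> x\<^esub> = homotopy_class \<Gamma> [x]" by (simp add: fundamental_group_def)
  have comp: "cycle_at \<Gamma> x (p @ tl q)" if "cycle_at \<Gamma> x p" "cycle_at \<Gamma> x q" for p q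
    using path_comp[of \<Gamma> p q] that by (auto simp: cycle_at_def)
  show ?thesis
  proof (rule groupI)
    fix y assume "y \<in> carrier (fundamental_group \<Gamma> x)"
    then obtain p where p: "cycle_at \<Gamma> x p" "y = homotopy_class \<Gamma> p" using car by blast
    have S: "\<And>x y. x \<in> elts \<Gamma> \<Longrightarrow> y \<in> elts \<Gamma> \<Longrightarrow> inc \<Gamma> x y \<Longrightarrow> inc \<Gamma> y x"
      using assms by (auto simp: pregeometry_def)
    have "cycle_at \<Gamma> x (rev p)" using path_rev[OF S] p by (auto simp: cycle_at_def hd_rev last_rev)
    moreover have "homotopic \<Gamma> (rev p @ tl p) [x]" using rev_homotopic[OF S, of p] p(1) by (simp add: cycle_at_def)
    ultimately show "\<exists>z\<in>carrier (fundamental_group \<Gamma> x). z \<otimes>\<^bsub>fundamental_group \<Gamma> x\<^esub> y = \<one>\<^bsub>fundamental_group \<Gamma> x\<^esub>"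
      using p mult_homotopy_class car one homotopy_class_eq by metis
    show "\<one>\<^bsub>fundamental_group \<Gamma> x\<^esub> \<otimes>\<^bsub>fundamental_group \<Gamma> x\<^esub> y = y"
      unfolding one p(2) mult_homotopy_class[OF c1 p(1)] using p(1)
      by (cases p) (auto simp: cycle_at_def path_def)
  next
    fix y z assume "y \<in> carrier (fundamental_group \<Gamma> x)" "z \<in> carrier (fundamental_group \<Gamma> x)"
    then show "y \<otimes>\<^bsub>fundamental_group \<Gamma> x\<^esub> z \<in> carrier (fundamental_group \<Gamma> x)"
      unfolding car using comp mult_homotopy_class by metis
  next
    fix u v w assume "u \<in> carrier (fundamental_group \<Gamma> x)" "v \<in> carrier (fundamental_group \<Gamma> x)"
      "w \<in> carrier (fundamental_group \<Gamma> x)"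
    then obtain p q r where *: "cycle_at \<Gamma> x p" "u = homotopy_class \<Gamma> p" "cycle_at \<Gamma> x q" "v = homotopy_class \<Gamma> q"
      "cycle_at \<Gamma> x r" "w = homotopy_class \<Gamma> r" unfolding car by blast
    then have "tl (q @ tl r) = tl q @ tl r" by (cases q) (auto simp: cycle_at_def path_def)
    with * show "u \<otimes>\<^bsub>fundamental_group \<Gamma> x\<^esub> v \<otimes>\<^bsub>fundamental_group \<Gamma> x\<^esub> w = u \<otimes>\<^bsub>fundamental_group \<Gamma> x\<^esub> (v \<otimes>\<^bsub>fundamental_group \<Gamma> x\<^esub> w)"
      by (simp add: mult_homotopy_class comp)
  qed (use car one c1 in auto)
qed

end

theory Submission
  imports Defs
begin

text \<open>
  The hypotheses say that \<open>G\<close> acts on the complex of vertices, edges and triangles of the geometry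
  with \<open>W\<close> as a strict fundamental domain: the hall property makes any two elements of \<open>W\<close> of
  different types incident, and transitivity on flags of cardinality two and three moves every edge
  and every triangle into \<open>W\<close> (\<open>flag_translate\<close>).  The domain \<open>W\<close> itself is complete multipartite
  with all triangles filled in, and with at least three parts such a complex is simply connected
  (\<open>multipartite_walks_homotopic\<close>).  The theorem is then an instance of a lemma of Tits: for a simply
  connected strict fundamental domain, the fundamental group of the complex is isomorphic to the
  kernel of the canonical map from the universal completion of the stabilizers onto \<open>G\<close>.

  The proof of that lemma translates words in the generators into paths and paths into words.  A word
  gives a path starting at a base point \<open>w0\<close> of \<open>W\<close>: an element \<open>g\<close> of the stabilizer of \<open>a\<close> becomes
  the path from \<open>w0\<close> through \<open>a\<close> to \<open>g w0\<close> consisting of a path inside \<open>W\<close> and the translate under \<open>g\<close>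
  of its reverse.  Equivalent words give homotopic paths (\<open>word_path_pres_eq\<close>).  In the other
  direction, each element \<open>x\<close> is the image of its representative in \<open>W\<close> under a chosen group element;
  along an edge the two choices differ by a product of two stabilizer elements, which lifts to the
  completion.  Multiplying these lifts along a path gives its holonomy, which is invariant under
  homotopy because each triangle lies in a single translate of \<open>W\<close> (\<open>holonomy_homotopic\<close>).  The two
  translations are inverse to each other up to homotopy and equivalence (\<open>word_path_path_word\<close>,
  \<open>holonomy_word_path\<close>).  Hence all closed paths are null-homotopic if and only if every word that
  denotes the identity of \<open>G\<close> is trivial in the completion.  Surjectivity of the canonical map
  follows from connectedness (\<open>canonical_map_surj\<close>).
\<close>


section \<open>Composition and homotopy of paths\<close>

definition join :: "'x list \<Rightarrow> 'x list \<Rightarrow> 'x list"  (infixr "\<Zcomp>" 70) where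
  "p \<Zcomp> q = p @ tl q"

lemma join_eq_Nil [simp]: "p \<Zcomp> q = [] \<longleftrightarrow> p = [] \<and> tl q = []"
  by (simp add: join_def)

lemma join_assoc: "q \<noteq> [] \<Longrightarrow> (p \<Zcomp> q) \<Zcomp> r = p \<Zcomp> (q \<Zcomp> r)"
  by (simp add: join_def)

lemma join_singleton [simp]: "p \<Zcomp> [x] = p"
  by (simp add: join_def)

lemma singleton_join: "q \<noteq> [] \<Longrightarrow> hd q = x \<Longrightarrow> [x] \<Zcomp> q = q"
  by (cases q) (auto simp: join_def)

lemma map_join: "map f (p \<Zcomp> q) = map f p \<Zcomp> map f q"
  by (simp add: join_def map_tl)

lemma Cons_Cons_join: "x # y # p = [x, y] \<Zcomp> (y # p)"
  by (simp add: join_def)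

lemma set_join_subset: "set p \<subseteq> A \<Longrightarrow> set q \<subseteq> A \<Longrightarrow> set (p \<Zcomp> q) \<subseteq> A"
  by (cases q) (auto simp: join_def)

definition walk :: "('x, 'i) pregeom \<Rightarrow> 'x \<Rightarrow> 'x list \<Rightarrow> 'x \<Rightarrow> bool" where
  "walk \<Gamma> x p y \<longleftrightarrow> path \<Gamma> p \<and> hd p = x \<and> last p = y"

lemma walk_not_Nil: "walk \<Gamma> x p y \<Longrightarrow> p \<noteq> []"
  by (simp add: walk_def path_def)

lemma walk_elts: "walk \<Gamma> x p y \<Longrightarrow> x \<in> elts \<Gamma> \<and> y \<in> elts \<Gamma>"
  by (auto simp: walk_def path_def)

lemma walk_join: "walk \<Gamma> x p y \<Longrightarrow> walk \<Gamma> y q z \<Longrightarrow> walk \<Gamma> x (p \<Zcomp> q) z"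
  unfolding walk_def join_def using path_comp[of \<Gamma> p q] by simp

lemma walk_edge: "x \<in> elts \<Gamma> \<Longrightarrow> y \<in> elts \<Gamma> \<Longrightarrow> inc \<Gamma> x y \<Longrightarrow> walk \<Gamma> x [x, y] y"
  by (simp add: walk_def path_def)

lemma walk_singleton: "x \<in> elts \<Gamma> \<Longrightarrow> walk \<Gamma> x [x] x"
  by (simp add: walk_def path_def)

lemma walk_induct [consumes 1, case_names single edge]:
  assumes "walk \<Gamma> x p y"
    and "\<And>x. x \<in> elts \<Gamma> \<Longrightarrow> P x [x] x"
    and "\<And>x y p z. walk \<Gamma> y p z \<Longrightarrow> x \<in> elts \<Gamma> \<Longrightarrow> y \<in> elts \<Gamma> \<Longrightarrow> inc \<Gamma> x y \<Longrightarrow> P y p z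
      \<Longrightarrow> P x ([x, y] \<Zcomp> p) z"
  shows "P x p y"
  using assms(1)
proof (induction p arbitrary: x)
  case Nil
  then show ?case by (simp add: walk_def path_def)
next
  case (Cons a p)
  show ?case
  proof (cases p)
    case Nil
    with Cons.prems assms(2) show ?thesis by (auto simp: walk_def path_def)
  next
    case (Cons b p')
    have "walk \<Gamma> b p y" "a \<in> elts \<Gamma>" "b \<in> elts \<Gamma>" "inc \<Gamma> a b" "a = x"
      using Cons.prems Cons by (auto simp: walk_def path_def)
    then show ?thesis
      using assms(3) Cons.IH Cons Cons_Cons_join by metis
  qed
qed

lemma insert_cycle_homotopic: "insert_cycle \<Gamma> p q \<Longrightarrow> homotopic \<Gamma> p q"
  unfolding homotopic_def by (rule r_into_equivclp)

lemma homotopic_walk: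
  assumes "homotopic \<Gamma> p q" "walk \<Gamma> x p y" shows "walk \<Gamma> x q y"
  using assms unfolding homotopic_def
  by (induction rule: equivclp_induct) (auto simp: walk_def dest: insert_cycle_ends)

text \<open>
  Composition of paths with arbitrary ends respects homotopy because a single insertion of a cycle
  stays one inside any longer path: the ends of the inserted piece agree, so nothing outside
  notices.
\<close>
lemma homotopic_in_context:
  assumes "homotopic \<Gamma> p q" "path \<Gamma> p" "path \<Gamma> (a @ p @ b)"
  shows "homotopic \<Gamma> (a @ p @ b) (a @ q @ b)"
proof -
  have step: "insert_cycle \<Gamma> (a @ r @ b) (a @ s @ b)"
    if i: "insert_cycle \<Gamma> r s" and "path \<Gamma> (a @ r @ b) \<or> path \<Gamma> (a @ s @ b)" for r s
  proof -
    have "hd r = hd s" "last r = last s" "path \<Gamma> r" "path \<Gamma> s"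
      using insert_cycle_ends[OF i] by auto
    with that(2) have "path \<Gamma> (a @ r @ b)" "path \<Gamma> (a @ s @ b)"
      by (auto simp: path_def successively_append_iff)
    moreover obtain c y d cc where "r = c @ [y] @ d" "s = c @ cc @ d" "cycle_at \<Gamma> y cc"
        "length cc - 1 \<in> {1,2,3}"
      using i unfolding insert_cycle_def by blast
    ultimately show ?thesis
      unfolding insert_cycle_def
      by (intro conjI exI[of _ "a @ c"] exI[of _ y] exI[of _ "d @ b"] exI[of _ cc]) auto
  qed
  from assms(1) have "path \<Gamma> (a @ q @ b) \<and> homotopic \<Gamma> (a @ p @ b) (a @ q @ b)"
    unfolding homotopic_def
  proof (induction rule: equivclp_induct)
    case base
    then show ?case using assms by simp
  next
    case (step r s)
    then have "insert_cycle \<Gamma> (a @ r @ b) (a @ s @ b) \<or> insert_cycle \<Gamma> (a @ s @ b) (a @ r @ b)"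
      using \<open>\<And>r s. _ \<Longrightarrow> _ \<Longrightarrow> insert_cycle \<Gamma> (a @ r @ b) (a @ s @ b)\<close> by blast
    then show ?case
      using step.IH insert_cycle_ends by (metis equivclp_sym equivclp_trans r_into_equivclp)
  qed
  then show ?thesis by simp
qed

lemma homotopic_join:
  assumes "homotopic \<Gamma> p p'" "homotopic \<Gamma> q q'" "walk \<Gamma> x p y" "walk \<Gamma> y q z"
  shows "homotopic \<Gamma> (p \<Zcomp> q) (p' \<Zcomp> q')"
proof -
  have p': "walk \<Gamma> x p' y" and q': "walk \<Gamma> y q' z"
    using assms homotopic_walk by metis+
  have "path \<Gamma> (p \<Zcomp> q)"
    using walk_join[OF assms(3,4)] by (simp add: walk_def)
  then have "homotopic \<Gamma> (p \<Zcomp> q) (p' \<Zcomp> q)"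
    using homotopic_in_context[OF assms(1), of "[]" "tl q"] assms(3) by (simp add: join_def walk_def)
  moreover have bl: "p' \<Zcomp> r = butlast p' @ r" if "walk \<Gamma> y r z" for r
    using that p' unfolding walk_def path_def join_def
    by (metis append.assoc append_Cons append_Nil append_butlast_last_id list.collapse)
  have "path \<Gamma> (p' \<Zcomp> q)"
    using walk_join[OF p' assms(4)] by (simp add: walk_def)
  then have "homotopic \<Gamma> (p' \<Zcomp> q) (p' \<Zcomp> q')"
    using homotopic_in_context[OF assms(2), of "butlast p'" "[]"] assms(4)
    unfolding bl[OF q'] bl[OF assms(4)] by (simp add: walk_def)
  ultimately show ?thesis by (rule homotopic_trans)
qed

locale incidence_structure =
  fixes \<Gamma> :: "('x, 'i) pregeom"
  assumes inc_refl: "x \<in> elts \<Gamma> \<Longrightarrow> inc \<Gamma> x x"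
    and inc_sym: "x \<in> elts \<Gamma> \<Longrightarrow> y \<in> elts \<Gamma> \<Longrightarrow> inc \<Gamma> x y \<Longrightarrow> inc \<Gamma> y x"
begin

lemma walk_rev: "walk \<Gamma> x p y \<Longrightarrow> walk \<Gamma> y (rev p) x"
  using path_rev[OF inc_sym, of p] by (auto simp: walk_def hd_rev last_rev path_def)

lemma rev_join_homotopic: "walk \<Gamma> x p y \<Longrightarrow> homotopic \<Gamma> (rev p \<Zcomp> p) [y]"
  using rev_homotopic[OF inc_sym, of p] by (auto simp: walk_def join_def)

lemma join_rev_homotopic: "walk \<Gamma> x p y \<Longrightarrow> homotopic \<Gamma> (p \<Zcomp> rev p) [x]"
  using rev_join_homotopic[OF walk_rev[of x p y]] by simp

lemma loop_homotopic: "x \<in> elts \<Gamma> \<Longrightarrow> homotopic \<Gamma> [x, x] [x]"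
  by (rule homotopic_sym, rule insert_cycle_homotopic, unfold insert_cycle_def, intro conjI exI[of _ "[]"] exI[of _ x] exI[of _ "[x, x]"])
    (auto simp: path_def cycle_at_def inc_refl)

text \<open>
  Both paths are contracted forms of \<open>(x, y, z, x, z)\<close>, which contains the triangle
  \<open>(x, y, z, x)\<close> and the backtracking \<open>(z, x, z)\<close>.
\<close>
lemma triangle_homotopic:
  assumes "x \<in> elts \<Gamma>" "y \<in> elts \<Gamma>" "z \<in> elts \<Gamma>" "inc \<Gamma> x y" "inc \<Gamma> y z" "inc \<Gamma> x z"
  shows "homotopic \<Gamma> ([x, y] \<Zcomp> [y, z]) [x, z]"
proof -
  have 1: "insert_cycle \<Gamma> [x, z] [x, y, z, x, z]"
    unfolding insert_cycle_def
    using assms inc_sym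
    by (intro conjI exI[of _ "[]"] exI[of _ x] exI[of _ "[z]"] exI[of _ "[x, y, z, x]"])
      (auto simp: path_def cycle_at_def)
  have 2: "insert_cycle \<Gamma> [x, y, z] [x, y, z, x, z]"
    unfolding insert_cycle_def
    using assms inc_sym
    by (intro conjI exI[of _ "[x, y]"] exI[of _ z] exI[of _ "[]"] exI[of _ "[z, x, z]"])
      (auto simp: path_def cycle_at_def)
  have "homotopic \<Gamma> [x, y, z] [x, z]"
    by (rule homotopic_trans[OF insert_cycle_homotopic[OF 2] homotopic_sym[OF insert_cycle_homotopic[OF 1]]])
  then show ?thesis by (simp add: join_def)
qed

lemma homotopic_cancel_left:
  assumes "walk \<Gamma> x p y" "walk \<Gamma> y q z" "walk \<Gamma> y q' z"
    and "homotopic \<Gamma> (p \<Zcomp> q) (p \<Zcomp> q')"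
  shows "homotopic \<Gamma> q q'"
proof -
  have *: "homotopic \<Gamma> (rev p \<Zcomp> p \<Zcomp> r) r" if "walk \<Gamma> y r z" for r
  proof -
    have "homotopic \<Gamma> ((rev p \<Zcomp> p) \<Zcomp> r) ([y] \<Zcomp> r)"
      using assms(1) that
      by (intro homotopic_join rev_join_homotopic walk_join walk_rev homotopic_refl)
    then show ?thesis
      using that assms(1) by (simp add: join_assoc singleton_join walk_def path_def)
  qed
  have "homotopic \<Gamma> (rev p \<Zcomp> p \<Zcomp> q) (rev p \<Zcomp> p \<Zcomp> q')"
    using assms by (intro homotopic_join[OF homotopic_refl assms(4)] walk_join walk_rev)
  then show ?thesis
    by (meson * assms(2,3) homotopic_sym homotopic_trans)
qed

end


section \<open>Strict fundamental domains\<close>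

text \<open>
  Here \<open>G\<close> acts on the complex whose simplices are the pairwise incident sets of at most three
  elements, and \<open>W\<close> is a subcomplex meeting each orbit of simplices exactly once: every such set
  can be moved into \<open>W\<close> as a whole (\<open>triangle_translate\<close>, where repetitions among the three
  elements cover vertices and edges), and different elements of \<open>W\<close> are never equivalent.  By the
  last two conditions \<open>W\<close> is connected and its closed paths contract in \<open>\<Gamma>\<close>.
\<close>
locale strict_fundamental_domain = incidence_structure \<Gamma> + group G
  for \<Gamma> :: "('x, 'i) pregeom" and G :: "('x \<Rightarrow> 'x) monoid" (structure) +
  fixes W :: "'x set" and w0 :: 'x
  assumes act_closed [simp]: "g \<in> carrier G \<Longrightarrow> x \<in> elts \<Gamma> \<Longrightarrow> g x \<in> elts \<Gamma>"
    and act_one [simp]: "x \<in> elts \<Gamma> \<Longrightarrow> \<one> x = x"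
    and act_mult [simp]:
      "g \<in> carrier G \<Longrightarrow> h \<in> carrier G \<Longrightarrow> x \<in> elts \<Gamma> \<Longrightarrow> (g \<otimes> h) x = g (h x)"
    and act_inc:
      "g \<in> carrier G \<Longrightarrow> x \<in> elts \<Gamma> \<Longrightarrow> y \<in> elts \<Gamma> \<Longrightarrow> inc \<Gamma> x y \<Longrightarrow> inc \<Gamma> (g x) (g y)"
    and W_subset: "W \<subseteq> elts \<Gamma>"
    and base: "w0 \<in> W"
    and orbit_unique: "a \<in> W \<Longrightarrow> g \<in> carrier G \<Longrightarrow> g a \<in> W \<Longrightarrow> g a = a"
    and triangle_translate:
      "x \<in> elts \<Gamma> \<Longrightarrow> y \<in> elts \<Gamma> \<Longrightarrow> z \<in> elts \<Gamma> \<Longrightarrow> inc \<Gamma> x y \<Longrightarrow> inc \<Gamma> y z \<Longrightarrow> inc \<Gamma> x z \<Longrightarrow>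
       \<exists>k\<in>carrier G. \<exists>a\<in>W. \<exists>b\<in>W. \<exists>c\<in>W. k a = x \<and> k b = y \<and> k c = z"
    and W_connected: "a \<in> W \<Longrightarrow> \<exists>p. walk \<Gamma> w0 p a \<and> set p \<subseteq> W"
    and W_simply_connected: "walk \<Gamma> a p b \<Longrightarrow> walk \<Gamma> a q b \<Longrightarrow> set p \<subseteq> W \<Longrightarrow> set q \<subseteq> W \<Longrightarrow>
      homotopic \<Gamma> p q"
begin

abbreviation "stab \<equiv> pointwise_stabilizer G"
abbreviation "gens \<equiv> amalgam_gens (parabolic_amalgam \<Gamma> G W)"
abbreviation "rels \<equiv> amalgam_rels (parabolic_amalgam \<Gamma> G W)"
abbreviation "completion \<equiv> universal_completion (parabolic_amalgam \<Gamma> G W)"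
abbreviation "word_class \<equiv> pres_class gens rels"
abbreviation "realize \<equiv> word_eval G snd"
abbreviation "is_word u \<equiv> u \<in> lists (gens \<times> UNIV)"


section \<open>The action\<close>

lemma W_elts [simp]: "a \<in> W \<Longrightarrow> a \<in> elts \<Gamma>"
  using W_subset by blast

lemma mult_inv_cancel [simp]:
  assumes "g \<in> carrier G" "h \<in> carrier G"
  shows "g \<otimes> (inv g \<otimes> h) = h" "inv g \<otimes> (g \<otimes> h) = h"
  using assms by (simp_all add: m_assoc[symmetric])

lemma act_inv [simp]:
  assumes "g \<in> carrier G" "x \<in> elts \<Gamma>"
  shows "(inv g) (g x) = x" "g ((inv g) x) = x"
  using assms act_mult[of "inv g" g x] act_mult[of g "inv g" x] by auto

lemma act_inv_eq: "g \<in> carrier G \<Longrightarrow> x \<in> elts \<Gamma> \<Longrightarrow> g x = y \<Longrightarrow> (inv g) y = x"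
  by auto

lemma stabD: "g \<in> stab U \<Longrightarrow> g \<in> carrier G" "g \<in> stab U \<Longrightarrow> a \<in> U \<Longrightarrow> g a = a"
  by (auto simp: pointwise_stabilizer_def)

lemma stabI: "g \<in> carrier G \<Longrightarrow> g a = a \<Longrightarrow> g \<in> stab {a}"
  by (auto simp: pointwise_stabilizer_def)

lemma stab_one: "a \<in> elts \<Gamma> \<Longrightarrow> \<one> \<in> stab {a}"
  by (simp add: stabI)

lemma stab_mult: "U \<subseteq> elts \<Gamma> \<Longrightarrow> g \<in> stab U \<Longrightarrow> h \<in> stab U \<Longrightarrow> g \<otimes> h \<in> stab U"
  by (auto simp: pointwise_stabilizer_def subset_iff)

lemma stab_inv: "U \<subseteq> elts \<Gamma> \<Longrightarrow> g \<in> stab U \<Longrightarrow> inv g \<in> stab U"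
  by (auto simp: pointwise_stabilizer_def subset_iff intro!: act_inv_eq)

lemma walk_map:
  assumes "g \<in> carrier G" "walk \<Gamma> x p y"
  shows "walk \<Gamma> (g x) (map g p) (g y)"
  using assms(2)
proof (induction rule: walk_induct)
  case (edge x y p z)
  then show ?case
    unfolding map_join using assms(1) act_inc[OF assms(1)]
    by (intro walk_join[of _ _ _ "g y"]) (simp_all add: walk_edge)
qed (simp add: walk_singleton assms)

lemma homotopic_map:
  assumes "g \<in> carrier G" "homotopic \<Gamma> p q"
  shows "homotopic \<Gamma> (map g p) (map g q)"
proof -
  have path: "path \<Gamma> (map g r)" if "path \<Gamma> r" for r
    using walk_map[OF assms(1), of "hd r" r "last r"] that by (simp add: walk_def)
  have step: "insert_cycle \<Gamma> (map g r) (map g s)" if i: "insert_cycle \<Gamma> r s" for r s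
  proof -
    obtain a y b c where *: "r = a @ [y] @ b" "s = a @ c @ b" "cycle_at \<Gamma> y c" "length c - 1 \<in> {1,2,3}"
      using i unfolding insert_cycle_def by blast
    moreover have "cycle_at \<Gamma> (g y) (map g c)"
      using walk_map[OF assms(1), of y c y] * by (simp add: walk_def cycle_at_def)
    moreover have "path \<Gamma> (map g r)" "path \<Gamma> (map g s)"
      using i path unfolding insert_cycle_def by blast+
    ultimately show ?thesis
      unfolding insert_cycle_def
      by (intro conjI exI[of _ "map g a"] exI[of _ "g y"] exI[of _ "map g b"] exI[of _ "map g c"]) auto
  qed
  from assms(2) show ?thesis
    unfolding homotopic_def
  proof (induction rule: equivclp_induct)
    case (step r s)
    then show ?case
      using \<open>\<And>r s. insert_cycle \<Gamma> r s \<Longrightarrow> insert_cycle \<Gamma> (map g r) (map g s)\<close>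
      by (metis equivclp_sym equivclp_trans r_into_equivclp)
  qed simp
qed

lemma walk_map_mult:
  assumes "g \<in> carrier G" "h \<in> carrier G" "walk \<Gamma> x p y"
  shows "map (g \<otimes> h) p = map g (map h p)"
  using assms by (auto simp: walk_def path_def)

lemma walk_map_one: "walk \<Gamma> x p y \<Longrightarrow> map \<one> p = p"
  by (auto simp: walk_def path_def intro!: map_idI)


section \<open>Representatives of elements\<close>

definition rep :: "'x \<Rightarrow> 'x" where
  "rep x = (SOME a. a \<in> W \<and> (\<exists>g\<in>carrier G. g a = x))"

text \<open>
  Choosing the identity on \<open>W\<close> makes the holonomy, defined below, trivial on paths inside \<open>W\<close>.
\<close>
definition translator :: "'x \<Rightarrow> ('x \<Rightarrow> 'x)" where
  "translator x = (if x \<in> W then \<one> else (SOME g. g \<in> carrier G \<and> g (rep x) = x))"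

definition edge_translator :: "'x \<Rightarrow> 'x \<Rightarrow> 'x \<Rightarrow> 'x" where
  "edge_translator x y = (SOME k. k \<in> carrier G \<and> k (rep x) = x \<and> k (rep y) = y)"

lemma rep_ex:
  assumes "x \<in> elts \<Gamma>" shows "rep x \<in> W \<and> (\<exists>g\<in>carrier G. g (rep x) = x)"
  unfolding rep_def
  by (rule someI_ex) (use triangle_translate[of x x x] inc_refl assms in blast)

lemma rep_W [simp]: "x \<in> elts \<Gamma> \<Longrightarrow> rep x \<in> W"
  using rep_ex by blast

lemma rep_eqI:
  assumes "a \<in> W" "g \<in> carrier G" "g a = x"
  shows "rep x = a"
proof -
  have "x \<in> elts \<Gamma>" using assms by auto
  then obtain h where h: "h \<in> carrier G" "h (rep x) = x" "rep x \<in> W"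
    using rep_ex by blast
  then have "(inv h \<otimes> g) a = rep x"
    using assms act_inv_eq by simp
  then show ?thesis
    using orbit_unique[of a "inv h \<otimes> g"] assms h by auto
qed

lemma rep_id [simp]: "a \<in> W \<Longrightarrow> rep a = a"
  by (rule rep_eqI[of _ \<one>]) auto

lemma rep_act [simp]:
  assumes "g \<in> carrier G" "x \<in> elts \<Gamma>" shows "rep (g x) = rep x"
proof -
  obtain h where "h \<in> carrier G" "h (rep x) = x" "rep x \<in> W"
    using rep_ex[OF assms(2)] by blast
  then show ?thesis
    using rep_eqI[of "rep x" "g \<otimes> h" "g x"] assms by simp
qed

lemma translator [simp]:
  assumes "x \<in> elts \<Gamma>"
  shows "translator x \<in> carrier G" "translator x (rep x) = x"
proof -
  have "translator x \<in> carrier G \<and> translator x (rep x) = x"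
  proof (cases "x \<in> W")
    case False
    then show ?thesis
      unfolding translator_def
      by (simp, intro someI_ex[of "\<lambda>g. g \<in> carrier G \<and> g (rep x) = x"]) (use rep_ex[OF assms] in blast)
  qed (simp add: translator_def)
  then show "translator x \<in> carrier G" "translator x (rep x) = x" by auto
qed

lemma translator_W [simp]: "a \<in> W \<Longrightarrow> translator a = \<one>"
  by (simp add: translator_def)

lemma triangle_rep:
  assumes "x \<in> elts \<Gamma>" "y \<in> elts \<Gamma>" "z \<in> elts \<Gamma>" "inc \<Gamma> x y" "inc \<Gamma> y z" "inc \<Gamma> x z"
  obtains k where "k \<in> carrier G" "k (rep x) = x" "k (rep y) = y" "k (rep z) = z"
  using triangle_translate[OF assms] rep_eqI by metis

lemma edge_translator:
  assumes "x \<in> elts \<Gamma>" "y \<in> elts \<Gamma>" "inc \<Gamma> x y"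
  shows "edge_translator x y \<in> carrier G" "edge_translator x y (rep x) = x"
    "edge_translator x y (rep y) = y"
proof -
  have "\<exists>k. k \<in> carrier G \<and> k (rep x) = x \<and> k (rep y) = y"
    using triangle_rep[of x y y] assms inc_refl by metis
  from someI_ex[OF this] show "edge_translator x y \<in> carrier G" "edge_translator x y (rep x) = x"
    "edge_translator x y (rep y) = y"
    by (auto simp: edge_translator_def)
qed

lemma inc_rep:
  assumes "x \<in> elts \<Gamma>" "y \<in> elts \<Gamma>" "inc \<Gamma> x y" shows "inc \<Gamma> (rep x) (rep y)"
proof -
  obtain k where "k \<in> carrier G" "k (rep x) = x" "k (rep y) = y"
    using edge_translator[OF assms] by blast
  then show ?thesis
    using act_inc[of "inv k" x y] assms act_inv_eq by (metis inv_closed rep_W W_elts)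
qed

lemma connecting_stab:
  assumes "a \<in> elts \<Gamma>" "g \<in> carrier G" "h \<in> carrier G" "g a = h a"
  shows "inv g \<otimes> h \<in> stab {a}"
  using assms by (intro stabI) (auto intro: act_inv_eq)


section \<open>The universal completion\<close>

lemma gens_iff: "(U, g) \<in> gens \<longleftrightarrow> U \<noteq> {} \<and> U \<subseteq> W \<and> flag \<Gamma> U \<and> g \<in> stab U"
  by (auto simp: amalgam_gens_def parabolic_amalgam_def Let_def)

lemma singleton_flag: "a \<in> W \<Longrightarrow> flag \<Gamma> {a}"
  by (simp add: flag_def inc_refl)

sublocale completion: group completion
  unfolding universal_completion_def by (rule group_presented_group)

lemma word_class_closed [simp]: "is_word u \<Longrightarrow> word_class u \<in> carrier completion"
  by (simp add: universal_completion_def presented_group_def)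

lemma word_class_append:
  "is_word u \<Longrightarrow> is_word v \<Longrightarrow> word_class (u @ v) = word_class u \<otimes>\<^bsub>completion\<^esub> word_class v"
  by (simp add: universal_completion_def mult_pres_class)

lemma word_class_Nil: "word_class [] = \<one>\<^bsub>completion\<^esub>"
  by (simp add: universal_completion_def presented_group_def)

lemma completion_elt:
  assumes "c \<in> carrier completion" obtains u where "is_word u" "c = word_class u"
  using assms by (auto simp: universal_completion_def presented_group_def)

lemma word_class_eq_iff:
  assumes "is_word u" "is_word v"
  shows "word_class u = word_class v \<longleftrightarrow> pres_eq gens rels u v"
proof
  assume "word_class u = word_class v"
  then have "v \<in> word_class u"
    using assms(2) by (auto simp: pres_class_def intro: pres_eq.refl)
  then show "pres_eq gens rels u v" by (simp add: pres_class_def)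
qed (rule pres_class_eq)

lemma snd_gens: "snd \<in> gens \<rightarrow> carrier G"
  by (auto simp: gens_iff dest: stabD)

lemma realize_closed [simp]: "is_word u \<Longrightarrow> realize u \<in> carrier G"
  by (rule word_eval_closed[OF snd_gens])

lemma realize_append:
  "is_word u \<Longrightarrow> is_word v \<Longrightarrow> realize (u @ v) = realize u \<otimes> realize v"
  by (rule word_eval_append[OF snd_gens])

lemma canonical_map_word_class:
  "is_word u \<Longrightarrow> canonical_map G (word_class u) = realize u"
  unfolding canonical_map_def
  by (rule induced_map_pres_class[OF snd_gens])
    (auto simp: amalgam_rels_def parabolic_amalgam_def Let_def pointwise_stabilizer_def)

text \<open>
  Singletons \<open>{a}\<close> suffice as indices: the group of a larger flag is identified with a subgroup of
  the stabilizer of each of its elements.  So the completion is generated by the letters, subject to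
  the multiplication of each stabilizer and to \<open>letter_change\<close> along the edges of \<open>W\<close>.
\<close>
definition letter :: "'x \<Rightarrow> ('x \<Rightarrow> 'x) \<Rightarrow> ('x set \<times> ('x \<Rightarrow> 'x)) word set" where
  "letter a g = word_class [(({a}, g), True)]"

lemma letter_word: "a \<in> W \<Longrightarrow> g \<in> stab {a} \<Longrightarrow> is_word [(({a}, g), True)]"
  by (simp add: gens_iff singleton_flag)

lemma letter_closed [simp]: "a \<in> W \<Longrightarrow> g \<in> stab {a} \<Longrightarrow> letter a g \<in> carrier completion"
  unfolding letter_def by (rule word_class_closed[OF letter_word])

lemma generator_eq_letter:
  assumes "(U, g) \<in> gens" "a \<in> U"
  shows "word_class [((U, g), True)] = letter a g"
proof -
  have a: "a \<in> W" "g \<in> stab {a}" "U \<noteq> {}" "U \<subseteq> W" "flag \<Gamma> U" "g \<in> stab U"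
    using assms by (auto simp: gens_iff pointwise_stabilizer_def)
  have "([((U, g), True)], [(({a}, g), True)]) \<in> rels"
    unfolding amalgam_rels_def parabolic_amalgam_def Let_def
    using a assms(2) singleton_flag[OF a(1)] by simp
  then show ?thesis
    unfolding letter_def
    by (intro pres_class_eq pres_eq.rel letter_word a) (use assms(1) in auto)
qed

lemma letter_change:
  assumes "a \<in> W" "b \<in> W" "inc \<Gamma> a b" "g \<in> stab {a}" "g \<in> stab {b}"
  shows "letter a g = letter b g"
proof -
  have "({a, b}, g) \<in> gens"
    using assms by (auto simp: gens_iff flag_def inc_refl inc_sym pointwise_stabilizer_def)
  then show ?thesis
    using generator_eq_letter[of "{a, b}" g a] generator_eq_letter[of "{a, b}" g b] by simp
qed

lemma letter_mult:
  assumes "a \<in> W" "g \<in> stab {a}" "h \<in> stab {a}"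
  shows "letter a g \<otimes>\<^bsub>completion\<^esub> letter a h = letter a (g \<otimes> h)"
proof -
  have gh: "g \<otimes> h \<in> stab {a}" using assms by (intro stab_mult) auto
  have "([(({a}, g), True), (({a}, h), True)], [(({a}, g \<otimes> h), True)]) \<in> rels"
    unfolding amalgam_rels_def parabolic_amalgam_def Let_def
    using assms singleton_flag by auto
  then have "word_class ([(({a}, g), True)] @ [(({a}, h), True)]) = letter a (g \<otimes> h)"
    unfolding letter_def
    by (intro pres_class_eq pres_eq.rel) (use assms letter_word gh in auto)
  then show ?thesis
    unfolding letter_def
    by (subst (asm) word_class_append) (use assms letter_word in blast)+
qed

lemma letter_one: "a \<in> W \<Longrightarrow> letter a \<one> = \<one>\<^bsub>completion\<^esub>"
  using letter_mult[of a \<one> \<one>] stab_one[of a] letter_closed[of a \<one>]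
  by (simp add: completion.l_cancel_one)

lemma letter_inv:
  assumes "a \<in> W" "g \<in> stab {a}"
  shows "inv\<^bsub>completion\<^esub> (letter a g) = letter a (inv g)"
proof -
  have "inv g \<in> stab {a}" "g \<in> carrier G" using assms stab_inv[of "{a}" g] by (auto dest: stabD)
  then show ?thesis
    using assms letter_mult[of a "inv g" g] letter_one[of a]
    by (intro completion.inv_equality) auto
qed

lemma generator_inverse:
  assumes "(U, g) \<in> gens" "a \<in> U"
  shows "word_class [((U, g), False)] = letter a (inv g)"
proof -
  have a: "a \<in> W" "g \<in> stab {a}"
    using assms by (auto simp: gens_iff pointwise_stabilizer_def)
  have "pres_eq gens rels ([((U, g), False)] @ [((U, g), True)]) []"
    using pres_eq.cancel[OF assms(1), of rels False] by simp
  then have "word_class ([((U, g), False)] @ [((U, g), True)]) = \<one>\<^bsub>completion\<^esub>"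
    unfolding word_class_Nil[symmetric] by (rule pres_class_eq)
  then have "word_class [((U, g), False)] \<otimes>\<^bsub>completion\<^esub> letter a g = \<one>\<^bsub>completion\<^esub>"
    unfolding generator_eq_letter[OF assms, symmetric]
    using assms by (subst (asm) word_class_append) auto
  then have "inv\<^bsub>completion\<^esub> (letter a g) = word_class [((U, g), False)]"
    by (intro completion.inv_equality) (use a assms in auto)
  then show ?thesis using letter_inv[OF a] by simp
qed


section \<open>From paths to words\<close>

text \<open>
  The two ends of an edge are moved to \<open>W\<close> by a common element \<open>k\<close>.  Comparing \<open>k\<close> with the chosen
  translators of the ends gives one element of each of the two stabilizers.  Right multiplication
  by their product in \<open>G\<close> turns the translator of \<open>x\<close> into that of \<open>y\<close>, and the word lifts this
  product to the completion.
\<close>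
definition edge_word :: "'x \<Rightarrow> 'x \<Rightarrow> ('x set \<times> ('x \<Rightarrow> 'x)) word" where
  "edge_word x y =
     [(({rep x}, inv (translator x) \<otimes> edge_translator x y), True),
      (({rep y}, inv (edge_translator x y) \<otimes> translator y), True)]"

fun path_word :: "'x list \<Rightarrow> ('x set \<times> ('x \<Rightarrow> 'x)) word" where
  "path_word (x # y # p) = edge_word x y @ path_word (y # p)"
| "path_word _ = []"

text \<open>
  The edges of \<open>\<Gamma>\<close> are thus labelled by elements of the completion; the holonomy of a path is the
  product of its labels.
\<close>
abbreviation "holonomy p \<equiv> word_class (path_word p)"

context
  fixes x y
  assumes xy: "x \<in> elts \<Gamma>" "y \<in> elts \<Gamma>" "inc \<Gamma> x y"
begin

lemma edge_stab:
  assumes "k \<in> carrier G" "k (rep x) = x" "k (rep y) = y"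
  shows "inv (translator x) \<otimes> k \<in> stab {rep x}" "inv k \<otimes> translator y \<in> stab {rep y}"
  using assms xy by (auto intro!: connecting_stab)

lemma edge_is_word: "is_word (edge_word x y)"
  unfolding edge_word_def
  using edge_stab[OF edge_translator[OF xy]] xy by (simp add: gens_iff singleton_flag)

lemma realize_edge_word: "realize (edge_word x y) = inv (translator x) \<otimes> translator y"
  unfolding edge_word_def
  using edge_translator[OF xy] xy by (simp add: m_assoc)

text \<open>
  Two choices of \<open>k\<close> differ by an element that fixes both ends of the edge in \<open>W\<close>.  In the
  completion such an element is the same letter at either end, so it can be carried from one factor
  to the other.
\<close>
lemma edge_class:
  assumes k: "k \<in> carrier G" "k (rep x) = x" "k (rep y) = y"
  shows "word_class (edge_word x y) =
    letter (rep x) (inv (translator x) \<otimes> k) \<otimes>\<^bsub>completion\<^esub> letter (rep y) (inv k \<otimes> translator y)"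
proof -
  define l where "l = edge_translator x y"
  note l = edge_translator[OF xy, folded l_def]
  let ?t = "inv l \<otimes> k"
  have t: "?t \<in> stab {rep x}" "?t \<in> stab {rep y}"
    using xy k l by (auto intro!: connecting_stab)
  have eqs: "inv (translator x) \<otimes> k = (inv (translator x) \<otimes> l) \<otimes> ?t"
      "inv l \<otimes> translator y = ?t \<otimes> (inv k \<otimes> translator y)"
    using k l xy by (simp_all add: m_assoc)
  note kst = edge_stab[OF k] and lst = edge_stab[OF l]
  have "word_class (edge_word x y) = letter (rep x) (inv (translator x) \<otimes> l)
      \<otimes>\<^bsub>completion\<^esub> letter (rep y) (inv l \<otimes> translator y)"
    unfolding letter_def using lst xy
    by (subst word_class_append[symmetric]) (auto simp: edge_word_def l_def gens_iff singleton_flag)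
  also have "\<dots> = letter (rep x) (inv (translator x) \<otimes> l) \<otimes>\<^bsub>completion\<^esub>
      (letter (rep y) ?t \<otimes>\<^bsub>completion\<^esub> letter (rep y) (inv k \<otimes> translator y))"
    using t kst xy by (simp only: eqs(2) letter_mult rep_W)
  also have "letter (rep y) ?t = letter (rep x) ?t"
    using t xy inc_rep[OF xy] by (intro letter_change) (auto intro: inc_sym)
  also have "letter (rep x) (inv (translator x) \<otimes> l) \<otimes>\<^bsub>completion\<^esub>
      (letter (rep x) ?t \<otimes>\<^bsub>completion\<^esub> letter (rep y) (inv k \<otimes> translator y)) =
      letter (rep x) (inv (translator x) \<otimes> k) \<otimes>\<^bsub>completion\<^esub> letter (rep y) (inv k \<otimes> translator y)"
    using t kst lst xy
    by (simp only: eqs(1) letter_mult[symmetric] rep_W completion.m_assoc letter_closed)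
  finally show ?thesis .
qed

end

lemma path_word_edge: "walk \<Gamma> y p z \<Longrightarrow> path_word ([x, y] \<Zcomp> p) = edge_word x y @ path_word p"
  by (cases p) (auto simp: walk_def path_def join_def)

lemma path_word_join:
  assumes "walk \<Gamma> x p y" "walk \<Gamma> y q z"
  shows "path_word (p \<Zcomp> q) = path_word p @ path_word q"
  using assms
proof (induction rule: walk_induct)
  case (single x)
  then show ?case by (simp add: singleton_join walk_def path_def)
next
  case (edge x y p v)
  then show ?case
    using path_word_edge[OF edge.hyps(1)] path_word_edge[OF walk_join[OF edge.hyps(1) edge.prems]]
    by (simp add: join_assoc walk_not_Nil[OF edge.hyps(1)])
qed

lemma path_is_word: "walk \<Gamma> x p y \<Longrightarrow> is_word (path_word p)"
proof (induction rule: walk_induct)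
  case (edge x y p z)
  then show ?case
    using edge_is_word[OF edge.hyps(2-4)] path_word_edge[OF edge.hyps(1)] by auto
qed simp

lemma realize_path_word:
  "walk \<Gamma> x p y \<Longrightarrow> realize (path_word p) = inv (translator x) \<otimes> translator y"
proof (induction rule: walk_induct)
  case (edge x y p z)
  have "z \<in> elts \<Gamma>" using walk_elts[OF edge.hyps(1)] by simp
  then show ?case
    using edge realize_append[OF edge_is_word[OF edge.hyps(2-4)] path_is_word[OF edge.hyps(1)]]
    by (simp add: path_word_edge[OF edge.hyps(1)] realize_edge_word m_assoc)
qed simp

lemma holonomy_closed [simp]: "walk \<Gamma> x p y \<Longrightarrow> holonomy p \<in> carrier completion"
  by (rule word_class_closed[OF path_is_word])

lemma holonomy_join:
  "walk \<Gamma> x p y \<Longrightarrow> walk \<Gamma> y q z \<Longrightarrow> holonomy (p \<Zcomp> q) = holonomy p \<otimes>\<^bsub>completion\<^esub> holonomy q"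
  by (simp add: path_word_join word_class_append path_is_word)

text \<open>
  One element \<open>k\<close> moves the whole triangle into \<open>W\<close> and can serve for all three edges; the two
  factors at the middle vertex are then inverse to each other.
\<close>
lemma holonomy_triangle:
  assumes "x \<in> elts \<Gamma>" "y \<in> elts \<Gamma>" "z \<in> elts \<Gamma>" "inc \<Gamma> x y" "inc \<Gamma> y z" "inc \<Gamma> x z"
  shows "holonomy [x, y] \<otimes>\<^bsub>completion\<^esub> holonomy [y, z] = holonomy [x, z]"
proof -
  obtain k where k: "k \<in> carrier G" "k (rep x) = x" "k (rep y) = y" "k (rep z) = z"
    using triangle_rep[OF assms] .
  let ?xk = "inv (translator x) \<otimes> k" and ?ky = "inv k \<otimes> translator y"
    and ?yk = "inv (translator y) \<otimes> k" and ?kz = "inv k \<otimes> translator z"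
  have st: "?xk \<in> stab {rep x}" "?ky \<in> stab {rep y}" "?yk \<in> stab {rep y}" "?kz \<in> stab {rep z}"
    using assms k edge_stab by blast+
  have "?ky \<otimes> ?yk = \<one>"
    using assms k by (simp add: m_assoc)
  then have "letter (rep y) ?ky \<otimes>\<^bsub>completion\<^esub> letter (rep y) ?yk = \<one>\<^bsub>completion\<^esub>"
    using letter_mult st letter_one assms by simp
  then have *: "letter (rep y) ?ky \<otimes>\<^bsub>completion\<^esub> (letter (rep y) ?yk \<otimes>\<^bsub>completion\<^esub> c) = c"
    if "c \<in> carrier completion" for c
    using that st assms by (simp add: completion.m_assoc[symmetric])
  show ?thesis
    using assms st edge_class[of x y, OF _ _ _ k(1-3)] edge_class[of y z, OF _ _ _ k(1,3,4)]
      edge_class[of x z, OF _ _ _ k(1,2,4)]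
    by (simp add: completion.m_assoc *)
qed

lemma holonomy_loop: "x \<in> elts \<Gamma> \<Longrightarrow> holonomy [x, x] = \<one>\<^bsub>completion\<^esub>"
  using holonomy_triangle[of x x x] inc_refl[of x] holonomy_closed[of x "[x, x]" x]
  by (simp add: completion.l_cancel_one walk_edge)

lemma holonomy_short_cycle:
  assumes "cycle_at \<Gamma> x c" "length c - 1 \<in> {1, 2, 3}"
  shows "holonomy c = \<one>\<^bsub>completion\<^esub>"
proof -
  have x: "x \<in> elts \<Gamma>" using assms(1) by (auto simp: cycle_at_def path_def)
  have backtrack: "holonomy [x, y] \<otimes>\<^bsub>completion\<^esub> holonomy [y, x] = \<one>\<^bsub>completion\<^esub>"
    if "y \<in> elts \<Gamma>" "inc \<Gamma> x y" for y
    using holonomy_triangle[of x y x] that x holonomy_loop inc_refl inc_sym by simp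
  consider "length c = 2" | "length c = 3" | "length c = 4" using assms(2) by fastforce
  then show ?thesis
  proof cases
    case 1
    then have "c = [x, x]" using assms(1)
      by (auto simp: numeral_eq_Suc length_Suc_conv cycle_at_def)
    then show ?thesis using holonomy_loop x by simp
  next
    case 2
    then obtain y where c: "c = [x, y] \<Zcomp> [y, x]" and y: "y \<in> elts \<Gamma>" "inc \<Gamma> x y" "inc \<Gamma> y x"
      using assms(1) by (auto simp: numeral_eq_Suc length_Suc_conv cycle_at_def path_def join_def)
    show ?thesis
      unfolding c using backtrack x y by (subst holonomy_join[OF walk_edge walk_edge]) auto
  next
    case 3
    then obtain y z where c: "c = ([x, y] \<Zcomp> [y, z]) \<Zcomp> [z, x]"
      and yz: "y \<in> elts \<Gamma>" "z \<in> elts \<Gamma>" "inc \<Gamma> x y" "inc \<Gamma> y z" "inc \<Gamma> z x"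
      using assms(1) by (auto simp: numeral_eq_Suc length_Suc_conv cycle_at_def path_def join_def)
    have "inc \<Gamma> x z" using inc_sym[of z x] yz x by blast
    have "holonomy c = (holonomy [x, y] \<otimes>\<^bsub>completion\<^esub> holonomy [y, z]) \<otimes>\<^bsub>completion\<^esub> holonomy [z, x]"
      unfolding c using x yz
      by (subst holonomy_join[OF walk_join[OF walk_edge walk_edge] walk_edge], simp_all del: path_word.simps)
        (subst holonomy_join[OF walk_edge walk_edge], simp_all del: path_word.simps)
    then show ?thesis
      using holonomy_triangle[of x y z] backtrack[of z] x yz \<open>inc \<Gamma> x z\<close> by simp
  qed
qed

lemma holonomy_insert_cycle:
  assumes "insert_cycle \<Gamma> p q" shows "holonomy p = holonomy q"
proof -
  obtain a x b c where p: "p = a @ [x] @ b" and q: "q = a @ c @ b"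
    and c: "cycle_at \<Gamma> x c" "length c - 1 \<in> {1,2,3}" and path: "path \<Gamma> p"
    using assms unfolding insert_cycle_def by blast
  have w: "walk \<Gamma> (hd (a @ [x])) (a @ [x]) x" "walk \<Gamma> x (x # b) (last (x # b))" "walk \<Gamma> x c x"
    using path c(1) unfolding p
    by (auto simp: walk_def path_def cycle_at_def successively_append_iff)
  have c': "c = x # tl c"
    using c(1) by (cases c) (auto simp: cycle_at_def path_def)
  have "p = (a @ [x]) \<Zcomp> (x # b)" by (simp add: p join_def)
  moreover have "q = (a @ [x]) \<Zcomp> (c \<Zcomp> (x # b))" using c' by (cases c) (auto simp: q join_def)
  ultimately show ?thesis
    using holonomy_join[OF w(1) w(2)] holonomy_join[OF w(1) walk_join[OF w(3) w(2)]]
      holonomy_join[OF w(3) w(2)] holonomy_short_cycle[OF c] holonomy_closed[OF w(2)]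
    by (simp del: path_word.simps)
qed

lemma holonomy_homotopic:
  assumes "homotopic \<Gamma> p q" shows "holonomy p = holonomy q"
  using assms unfolding homotopic_def
  by (induction rule: equivclp_induct) (auto dest: holonomy_insert_cycle)

lemma holonomy_W:
  assumes "walk \<Gamma> a p b" "set p \<subseteq> W" shows "holonomy p = \<one>\<^bsub>completion\<^esub>"
  using assms
proof (induction rule: walk_induct)
  case (edge a b p c)
  have "a \<in> W" "b \<in> W" "set p \<subseteq> W"
    using edge.prems edge.hyps(1) by (cases p; auto simp: join_def walk_def path_def)+
  then have "holonomy [a, b] = \<one>\<^bsub>completion\<^esub>"
    using edge_class[of a b \<one>] edge.hyps by (simp add: letter_one)
  then show ?case
    using edge \<open>set p \<subseteq> W\<close> by (simp add: holonomy_join[OF walk_edge] del: path_word.simps)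
qed (simp add: word_class_Nil)

text \<open>
  Translating a path by \<open>h\<close> changes each label by correction terms at its two ends, which depend
  only on the respective end.  Along a path the corrections at inner vertices cancel.
\<close>
lemma holonomy_map:
  assumes h: "h \<in> carrier G" and "walk \<Gamma> x p y"
  shows "holonomy (map h p) =
    letter (rep x) (inv (translator (h x)) \<otimes> h \<otimes> translator x) \<otimes>\<^bsub>completion\<^esub> holonomy p
    \<otimes>\<^bsub>completion\<^esub> letter (rep y) (inv (translator y) \<otimes> inv h \<otimes> translator (h y))"
proof -
  (* the corrections at x on the left and on the right; they are inverse to each other *)
  let ?A = "\<lambda>x. inv (translator (h x)) \<otimes> h \<otimes> translator x"
  let ?B = "\<lambda>x. inv (translator x) \<otimes> inv h \<otimes> translator (h x)"
  have st: "?A x \<in> stab {rep x}" "?B x \<in> stab {rep x}" if "x \<in> elts \<Gamma>" for x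
    using that h connecting_stab[of "rep x" "translator (h x)" "h \<otimes> translator x"]
      connecting_stab[of "rep x" "h \<otimes> translator x" "translator (h x)"] translator[of "h x"]
    by (simp_all add: m_assoc inv_mult_group)
  have AB: "letter (rep x) (?A x) \<otimes>\<^bsub>completion\<^esub> letter (rep x) (?B x) = \<one>\<^bsub>completion\<^esub>"
    "letter (rep x) (?B x) \<otimes>\<^bsub>completion\<^esub> letter (rep x) (?A x) = \<one>\<^bsub>completion\<^esub>"
    if "x \<in> elts \<Gamma>" for x
    using that h st[OF that] by (simp_all add: letter_mult letter_one m_assoc)
  show ?thesis
    using assms(2)
  proof (induction rule: walk_induct)
    case (single x)
    then show ?case using AB st by (simp add: word_class_Nil)
  next
    case (edge x y p z)
    have z: "z \<in> elts \<Gamma>" using walk_elts[OF edge.hyps(1)] by simp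
    define k where "k = edge_translator x y"
    note k = edge_translator[OF edge.hyps(2-4), folded k_def]
    have hk: "h \<otimes> k \<in> carrier G" "(h \<otimes> k) (rep (h x)) = h x" "(h \<otimes> k) (rep (h y)) = h y"
      using k h edge.hyps by simp_all
    note hinc = act_inc[OF h edge.hyps(2-4)]
    have e: "inv (translator (h x)) \<otimes> (h \<otimes> k) = ?A x \<otimes> (inv (translator x) \<otimes> k)"
        "inv (h \<otimes> k) \<otimes> translator (h y) = (inv k \<otimes> translator y) \<otimes> ?B y"
      using h k edge.hyps by (simp_all add: m_assoc inv_mult_group)
    have kst: "inv (translator x) \<otimes> k \<in> stab {rep x}" "inv k \<otimes> translator y \<in> stab {rep y}"
      using edge_stab k edge.hyps by blast+
    have "holonomy (map h [x, y]) = letter (rep x) (?A x) \<otimes>\<^bsub>completion\<^esub> holonomy [x, y]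
        \<otimes>\<^bsub>completion\<^esub> letter (rep y) (?B y)"
      using edge_class[OF _ _ hinc hk] edge_class[OF edge.hyps(2-4) k] h edge.hyps kst st
      by (simp add: e letter_mult[symmetric] completion.m_assoc)
    moreover have "letter (rep y) (?B y) \<otimes>\<^bsub>completion\<^esub> (letter (rep y) (?A y) \<otimes>\<^bsub>completion\<^esub> c) = c"
      if "c \<in> carrier completion" for c
      using that AB[of y] st[of y] edge.hyps(3) by (simp add: completion.m_assoc[symmetric])
    moreover have "holonomy ([x, y] \<Zcomp> p) = holonomy [x, y] \<otimes>\<^bsub>completion\<^esub> holonomy p"
      using holonomy_join[OF walk_edge edge.hyps(1)] edge.hyps by blast
    moreover have "holonomy (map h [x, y] \<Zcomp> map h p) = holonomy (map h [x, y]) \<otimes>\<^bsub>completion\<^esub> holonomy (map h p)"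
      using holonomy_join[OF walk_map[OF h walk_edge] walk_map[OF h edge.hyps(1)]] edge.hyps by blast
    moreover have "holonomy [x, y] \<in> carrier completion" "holonomy p \<in> carrier completion"
      using holonomy_closed[OF walk_edge] holonomy_closed[OF edge.hyps(1)] edge.hyps by blast+
    ultimately show ?case
      unfolding map_join edge.IH using st edge.hyps z
      by (simp add: completion.m_assoc del: path_word.simps list.map)
  qed
qed


section \<open>From words to paths\<close>

text \<open>
  An element \<open>g\<close> fixing \<open>a\<close> is represented by a lasso: follow the spoke from the base point out to
  \<open>a\<close> and return along the translate of the spoke, which also ends in \<open>a\<close>.  A word is represented
  by successively translated lassos; its path runs from \<open>w0\<close> to the image of \<open>w0\<close> under the group
  element that the word denotes.  For a generator with index \<open>U\<close> any element of \<open>U\<close> may be used as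
  \<open>a\<close>, by \<open>lasso_change\<close>.
\<close>
definition spoke :: "'x \<Rightarrow> 'x list" where
  "spoke a = (SOME p. walk \<Gamma> w0 p a \<and> set p \<subseteq> W)"

definition lasso :: "'x \<Rightarrow> ('x \<Rightarrow> 'x) \<Rightarrow> 'x list" where
  "lasso a g = spoke a \<Zcomp> map g (rev (spoke a))"

fun word_path :: "('x set \<times> ('x \<Rightarrow> 'x)) word \<Rightarrow> 'x list" where
  "word_path [] = [w0]"
| "word_path (((U, h), b) # u) =
     (let g = (if b then h else inv h) in lasso (SOME a. a \<in> U) g \<Zcomp> map g (word_path u))"

lemma spoke:
  assumes "a \<in> W"
  shows spoke_walk: "walk \<Gamma> w0 (spoke a) a" and spoke_subset: "set (spoke a) \<subseteq> W"
  using someI_ex[OF W_connected[OF assms]] by (auto simp: spoke_def)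

lemma spoke_map_walk:
  "a \<in> W \<Longrightarrow> g \<in> carrier G \<Longrightarrow> g a = x \<Longrightarrow> walk \<Gamma> (g w0) (map g (spoke a)) x"
  using walk_map[OF _ spoke_walk] by blast

lemma spoke_map_rev_walk:
  "a \<in> W \<Longrightarrow> g \<in> carrier G \<Longrightarrow> g a = x \<Longrightarrow> walk \<Gamma> x (map g (rev (spoke a))) (g w0)"
  using walk_map[OF _ walk_rev[OF spoke_walk]] by blast

lemma lasso_walk: "a \<in> W \<Longrightarrow> g \<in> stab {a} \<Longrightarrow> walk \<Gamma> w0 (lasso a g) (g w0)"
  unfolding lasso_def
  using walk_join[OF spoke_walk spoke_map_rev_walk] stabD(1)[of g "{a}"] stabD(2)[of g "{a}" a] by blast

lemma spoke_rev_cancel: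
  assumes "a \<in> W" "g \<in> carrier G" "g a = x"
  shows "homotopic \<Gamma> (map g (rev (spoke a)) \<Zcomp> map g (spoke a)) [x]"
  using homotopic_map[OF assms(2) rev_join_homotopic[OF spoke_walk[OF assms(1)]]] assms(3)
  by (simp add: map_join)

text \<open>
  The return of the first lasso and the start of the second translated one are inverse to each other.
\<close>
lemma lasso_mult:
  assumes a: "a \<in> W" and g: "g \<in> stab {a}" and h: "h \<in> stab {a}"
  shows "homotopic \<Gamma> (lasso a g \<Zcomp> map g (lasso a h)) (lasso a (g \<otimes> h))"
proof -
  have gh: "g \<in> carrier G" "h \<in> carrier G" "g a = a" "h a = a" "(g \<otimes> h) a = a"
    using a stabD(1)[OF g] stabD(1)[OF h] stabD(2)[OF g, of a] stabD(2)[OF h, of a] by simp_all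
  let ?s = "spoke a" and ?r = "rev (spoke a)"
  note w = spoke_walk[OF a] and wr = walk_rev[OF spoke_walk[OF a]]
  have "lasso a g \<Zcomp> map g (lasso a h) = ?s \<Zcomp> (map g ?r \<Zcomp> map g ?s) \<Zcomp> map (g \<otimes> h) ?r"
    using walk_not_Nil[OF w]
    by (simp add: lasso_def map_join join_assoc walk_map_mult[OF gh(1,2) wr] del: map_map)
  moreover have "homotopic \<Gamma> (?s \<Zcomp> (map g ?r \<Zcomp> map g ?s) \<Zcomp> map (g \<otimes> h) ?r)
      (?s \<Zcomp> [a] \<Zcomp> map (g \<otimes> h) ?r)"
  proof -
    have m: "walk \<Gamma> a (map g ?r) (g w0)" "walk \<Gamma> (g w0) (map g ?s) a"
        "walk \<Gamma> a (map (g \<otimes> h) ?r) ((g \<otimes> h) w0)"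
      using a gh spoke_map_rev_walk[of a g a] spoke_map_walk[of a g a]
        spoke_map_rev_walk[of a "g \<otimes> h" a] by blast+
    note m12 = walk_join[OF m(1,2)]
    show ?thesis
      by (rule homotopic_join[OF homotopic_refl homotopic_join[OF spoke_rev_cancel[OF a gh(1,3)]
              homotopic_refl m12 m(3)] w walk_join[OF m12 m(3)]])
  qed
  moreover have "?s \<Zcomp> [a] \<Zcomp> map (g \<otimes> h) ?r = lasso a (g \<otimes> h)"
    using spoke_map_rev_walk[of a "g \<otimes> h" a] a gh by (simp add: lasso_def singleton_join walk_def path_def)
  ultimately show ?thesis by simp
qed

lemma lasso_one: "a \<in> W \<Longrightarrow> homotopic \<Gamma> (lasso a \<one>) [w0]"
  unfolding lasso_def
  using join_rev_homotopic[OF spoke_walk] walk_map_one[OF walk_rev[OF spoke_walk]] by simp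

text \<open>
  Since paths inside \<open>W\<close> with the same ends are homotopic, the spoke to \<open>a\<close> may be replaced by
  the spoke to \<open>b\<close> followed by the edge to \<open>a\<close>.  As \<open>g\<close> fixes this edge, it is traversed forth and back.
\<close>
lemma lasso_change:
  assumes ab: "a \<in> W" "b \<in> W" "inc \<Gamma> a b" and g: "g \<in> stab {a}" "g \<in> stab {b}"
  shows "homotopic \<Gamma> (lasso a g) (lasso b g)"
proof -
  have g': "g \<in> carrier G" "g a = a" "g b = b"
    using stabD(1)[OF g(1)] stabD(2)[OF g(1), of a] stabD(2)[OF g(2), of b] by simp_all
  have ba: "inc \<Gamma> b a" using ab inc_sym by simp
  note wa = spoke_walk[OF ab(1)] and wb = spoke_walk[OF ab(2)]
  note e = walk_edge[of a \<Gamma> b, OF _ _ ab(3)] walk_edge[of b \<Gamma> a, OF _ _ ba]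
  have 1: "homotopic \<Gamma> (spoke a) (spoke b \<Zcomp> [b, a])"
    using ab e wa wb spoke_subset
    by (intro W_simply_connected[of w0 _ a] walk_join[OF wb] set_join_subset) auto
  have 2: "homotopic \<Gamma> (rev (spoke a)) ([a, b] \<Zcomp> rev (spoke b))"
    using ab e wa wb spoke_subset
    by (intro W_simply_connected[of a _ w0] walk_join[of _ a _ b] walk_rev set_join_subset) auto
  have 3: "homotopic \<Gamma> (map g (rev (spoke a))) ([a, b] \<Zcomp> map g (rev (spoke b)))"
    using homotopic_map[OF g'(1) 2] g' by (simp add: map_join)
  have "homotopic \<Gamma> (lasso a g) ((spoke b \<Zcomp> [b, a]) \<Zcomp> [a, b] \<Zcomp> map g (rev (spoke b)))"
    unfolding lasso_def
    using homotopic_join[OF 1 3 wa spoke_map_rev_walk] ab g' by simp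
  also have "(spoke b \<Zcomp> [b, a]) \<Zcomp> [a, b] \<Zcomp> map g (rev (spoke b)) =
      spoke b \<Zcomp> ([b, a] \<Zcomp> [a, b]) \<Zcomp> map g (rev (spoke b))"
    by (simp add: join_assoc)
  finally have "homotopic \<Gamma> (lasso a g) (spoke b \<Zcomp> ([b, a] \<Zcomp> [a, b]) \<Zcomp> map g (rev (spoke b)))" .
  moreover have "homotopic \<Gamma> \<dots> (spoke b \<Zcomp> [b] \<Zcomp> map g (rev (spoke b)))"
  proof -
    have "homotopic \<Gamma> ([b, a] \<Zcomp> [a, b]) [b]"
      using W_simply_connected[of b "[b, a] \<Zcomp> [a, b]" b "[b]"] walk_join[OF e(2) e(1)] ab
      by (simp add: walk_singleton) (simp add: join_def)
    note c = this
    have m: "walk \<Gamma> b ([b, a] \<Zcomp> [a, b]) b" "walk \<Gamma> b (map g (rev (spoke b))) (g w0)"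
      using walk_join[OF e(2) e(1)] spoke_map_rev_walk[of b g b] ab g' by auto
    show ?thesis
      by (rule homotopic_join[OF homotopic_refl homotopic_join[OF c homotopic_refl m] wb walk_join[OF m]])
  qed
  moreover have "spoke b \<Zcomp> [b] \<Zcomp> map g (rev (spoke b)) = lasso b g"
    using spoke_map_rev_walk[of b g b] ab g' by (simp add: lasso_def singleton_join walk_def path_def)
  ultimately show ?thesis using homotopic_trans by metis
qed

lemma foot:
  assumes "(U, g) \<in> gens"
  shows "(SOME a. a \<in> U) \<in> U" "(SOME a. a \<in> U) \<in> W"
    "(if b then g else inv g) \<in> stab {SOME a. a \<in> U}"
proof -
  show 1: "(SOME a. a \<in> U) \<in> U" using assms by (simp add: gens_iff some_in_eq)
  then show 2: "(SOME a. a \<in> U) \<in> W" using assms by (auto simp: gens_iff)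
  have "g \<in> stab {SOME a. a \<in> U}" using assms 1 by (auto simp: gens_iff pointwise_stabilizer_def)
  then show "(if b then g else inv g) \<in> stab {SOME a. a \<in> U}"
    using stab_inv[of "{SOME a. a \<in> U}" g] 2 by auto
qed

lemma word_path_walk: "is_word u \<Longrightarrow> walk \<Gamma> w0 (word_path u) (realize u w0)"
proof (induction u rule: word_path.induct)
  case 1
  then show ?case using base by (simp add: walk_singleton)
next
  case (2 U h b u)
  let ?g = "if b then h else inv h"
  have gen: "(U, h) \<in> gens" and u: "is_word u" using 2(2) by auto
  note f = foot[OF gen]
  have g: "?g \<in> carrier G" using stabD(1)[OF f(3)] .
  have r: "realize (((U, h), b) # u) = ?g \<otimes> realize u" by simp
  have "walk \<Gamma> w0 (lasso (SOME a. a \<in> U) ?g \<Zcomp> map ?g (word_path u)) (?g (realize u w0))"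
    using 2(1)[OF HOL.refl u] by (intro walk_join[OF lasso_walk[OF f(2,3)]] walk_map g)
  then show ?case
    unfolding r using g base u by (simp add: Let_def split del: if_split)
qed

lemma word_path_append:
  assumes "is_word u" "is_word v"
  shows "word_path (u @ v) = word_path u \<Zcomp> map (realize u) (word_path v)"
  using assms(1)
proof (induction u rule: word_path.induct)
  case 1
  then show ?case
    using word_path_walk[OF assms(2)] walk_map_one[OF word_path_walk[OF assms(2)]]
    by (simp add: singleton_join walk_def path_def)
next
  case (2 U h b u)
  let ?g = "if b then h else inv h"
  have gen: "(U, h) \<in> gens" and u: "is_word u" using 2(2) by auto
  have g: "?g \<in> carrier G" using stabD(1)[OF foot(3)[OF gen]] .
  have r: "realize (((U, h), b) # u) = ?g \<otimes> realize u" by simp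
  have "word_path u \<noteq> []" using walk_not_Nil[OF word_path_walk[OF u]] .
  then show ?case
    using 2(1)[OF HOL.refl u] unfolding r walk_map_mult[OF g realize_closed[OF u] word_path_walk[OF assms(2)]]
    by (simp add: Let_def join_assoc map_join split del: if_split)
qed

lemma word_path_letter: "word_path [((U, g), True)] = lasso (SOME a. a \<in> U) g"
  by (simp add: Let_def)

lemma realize_pres_eq:
  assumes "pres_eq gens rels u v" shows "realize u = realize v"
  using pres_class_eq[OF assms] canonical_map_word_class pres_eq_words[OF assms] by metis

text \<open>
  The relations of the amalgam hold for lassos up to homotopy, so the path of a word depends, up to
  homotopy, only on the element of the completion.
\<close>
lemma word_path_pres_eq: "pres_eq gens rels u v \<Longrightarrow> homotopic \<Gamma> (word_path u) (word_path v)"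
proof (induction rule: pres_eq.induct)
  case (rel u v)
  consider (mult) U g h where "(U, g) \<in> gens" "(U, h) \<in> gens"
      "u = [((U, g), True), ((U, h), True)]" "v = [((U, g \<otimes> h), True)]"
    | (ident) U V g where "(V, g) \<in> gens" "(U, g) \<in> gens" "U \<subseteq> V"
      "u = [((V, g), True)]" "v = [((U, g), True)]"
  proof -
    from rel(1) show thesis
      unfolding amalgam_rels_def
    proof (elim UnE CollectE exE conjE)
      fix U g h
      assume "(u, v) = ([((U, g), True), ((U, h), True)],
          [((U, g \<otimes>\<^bsub>grp (parabolic_amalgam \<Gamma> G W) U\<^esub> h), True)])"
      then show thesis
        using rel(2) that(1)[of U g h] by (auto simp: parabolic_amalgam_def Let_def)
    next
      fix V \<phi> U g
      assume "(u, v) = ([((V, g), True)], [((U, \<phi> g), True)])"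
        "(V, \<phi>, U) \<in> idents (parabolic_amalgam \<Gamma> G W)"
      then show thesis
        using rel(2,3) that(2)[of V g U] by (auto simp: parabolic_amalgam_def Let_def)
    qed
  qed
  then show ?case
  proof cases
    case mult
    then show ?thesis
      using lasso_mult[OF foot(2)[OF mult(1)] foot(3)[OF mult(1), of True] foot(3)[OF mult(2), of True]]
      by (simp add: Let_def)
  next
    case ident
    let ?a = "SOME a. a \<in> V" and ?b = "SOME b. b \<in> U"
    have "inc \<Gamma> ?a ?b"
      using foot(1)[OF ident(1)] foot(1)[OF ident(2)] ident(1,3) by (auto simp: gens_iff flag_def)
    then show ?thesis
      unfolding ident(4,5) word_path_letter
      using foot(2)[OF ident(1)] foot(2)[OF ident(2)] foot(3)[OF ident(1), of True] foot(3)[OF ident(2), of True]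
      by (intro lasso_change) auto
  qed
next
  case (cancel s b)
  obtain U h where s: "s = (U, h)" by force
  let ?a = "SOME a. a \<in> U" and ?g = "if b then h else inv h"
  have gen: "(U, h) \<in> gens" using cancel s by simp
  note f = foot[OF gen]
  have h: "h \<in> carrier G" using stabD(1) f(3)[of True] by simp
  then have g: "?g \<in> carrier G" "(if \<not> b then h else inv h) = inv ?g" by auto
  have "word_path [(s, b), (s, \<not> b)] = lasso ?a ?g \<Zcomp> map ?g (lasso ?a (inv ?g))"
    unfolding s word_path.simps Let_def g(2) by (simp split del: if_split)
  moreover have "homotopic \<Gamma> \<dots> (lasso ?a \<one>)"
    using lasso_mult[OF f(2) f(3)[of b] stab_inv[OF _ f(3)[of b]]] f(2) g(1)
    by (simp split del: if_split)
  ultimately show ?case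
    using lasso_one[OF f(2)] homotopic_trans by (metis word_path.simps(1))
next
  case (cong u u' v v')
  note w = pres_eq_words[OF cong.hyps(1)] pres_eq_words[OF cong.hyps(2)]
  then have r: "realize u \<in> carrier G" and u: "is_word u" and v: "is_word v" by auto
  have "homotopic \<Gamma> (word_path u \<Zcomp> map (realize u) (word_path v))
      (word_path u' \<Zcomp> map (realize u) (word_path v'))"
    by (rule homotopic_join[OF cong.IH(1) homotopic_map[OF r cong.IH(2)] word_path_walk[OF u]
          walk_map[OF r word_path_walk[OF v]]])
  then show ?case
    using w realize_pres_eq[OF cong.hyps(1)] by (simp add: word_path_append)
qed (auto intro: homotopic_refl homotopic_sym homotopic_trans)


section \<open>The two constructions are inverse to each other\<close>

abbreviation spoke_to :: "'x \<Rightarrow> 'x list" where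
  "spoke_to x \<equiv> map (translator x) (spoke (rep x))"

lemma spoke_to_walk: "x \<in> elts \<Gamma> \<Longrightarrow> walk \<Gamma> (translator x w0) (spoke_to x) x"
  by (rule spoke_map_walk) auto

text \<open>
  With \<open>a\<close> and \<open>b\<close> the representatives of \<open>x\<close> and \<open>y\<close>, the translated word path runs along the spoke
  to \<open>x\<close>, along the \<open>k\<close>-translates of the reversed spoke of \<open>a\<close> and the spoke of \<open>b\<close>, and back along
  the spoke to \<open>y\<close>.  The middle part is homotopic to the \<open>k\<close>-translate of the edge \<open>(a, b)\<close>, as paths
  inside \<open>W\<close> with the same ends are homotopic, and this translate is the edge \<open>(x, y)\<close>.
\<close>
lemma word_path_edge_word:
  assumes xy: "x \<in> elts \<Gamma>" "y \<in> elts \<Gamma>" "inc \<Gamma> x y"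
  shows "homotopic \<Gamma> (map (translator x) (word_path (edge_word x y)) \<Zcomp> spoke_to y)
    (spoke_to x \<Zcomp> [x, y])"
proof -
  define a b k where "a = rep x" "b = rep y" "k = edge_translator x y"
  have ab: "a \<in> W" "b \<in> W" "inc \<Gamma> a b" using xy inc_rep by (auto simp: a_b_k_def)
  note k = edge_translator[OF xy, folded a_b_k_def]
  have tr: "translator x \<in> carrier G" "translator x a = x" "translator y \<in> carrier G" "translator y b = y"
    using xy by (auto simp: a_b_k_def)
  let ?g = "inv (translator x) \<otimes> k" and ?h = "inv k \<otimes> translator y"
  let ?Sx = "map (translator x) (spoke a)" and ?Sy = "map (translator y) (spoke b)"
    and ?Ry = "map (translator y) (rev (spoke b))"
  let ?M = "map k (rev (spoke a)) \<Zcomp> map k (spoke b)"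
  have ne: "spoke a \<noteq> []" "spoke b \<noteq> []"
    using walk_not_Nil[OF spoke_walk] ab by blast+
  have el: "set (spoke a) \<subseteq> elts \<Gamma>" "set (spoke b) \<subseteq> elts \<Gamma>"
    using spoke_subset ab W_subset by blast+
  have "map (translator x) (word_path (edge_word x y)) \<Zcomp> ?Sy = ?Sx \<Zcomp> ?M \<Zcomp> (?Ry \<Zcomp> ?Sy)"
  proof -
    have "word_path (edge_word x y) = lasso a ?g \<Zcomp> map ?g (lasso b ?h)"
      by (simp add: edge_word_def Let_def a_b_k_def)
    moreover have "map (translator x) (map ?g r) = map k r" "map k (map ?h r) = map (translator y) r"
      if "set r \<subseteq> elts \<Gamma>" for r
      using that tr k by (auto simp: subset_iff)
    moreover have "?h ` set (spoke b) \<subseteq> elts \<Gamma>"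
      using el(2) tr k by auto
    ultimately show ?thesis
      using ne el by (simp add: lasso_def map_join join_assoc del: map_map)
  qed
  moreover have "homotopic \<Gamma> \<dots> (?Sx \<Zcomp> [x, y] \<Zcomp> [y])"
  proof -
    have "homotopic \<Gamma> (rev (spoke a) \<Zcomp> spoke b) [a, b]"
      using ab spoke_walk spoke_subset
      by (intro W_simply_connected[of a _ b] walk_join[of _ a _ w0] walk_rev walk_edge set_join_subset)
        auto
    then have M: "homotopic \<Gamma> ?M [x, y]"
      using homotopic_map[OF k(1)] k by (fastforce simp: map_join)
    have "homotopic \<Gamma> (?Ry \<Zcomp> ?Sy) [y]"
      using spoke_rev_cancel[of b "translator y" y] ab tr by blast
    note R = this
    have m: "walk \<Gamma> (translator x w0) ?Sx x" "walk \<Gamma> x ?M y" "walk \<Gamma> y (?Ry \<Zcomp> ?Sy) y"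
      using ab tr k spoke_map_walk[of a "translator x" x]
        walk_join[OF spoke_map_rev_walk[of a k x] spoke_map_walk[of b k y]]
        walk_join[OF spoke_map_rev_walk[of b "translator y" y] spoke_map_walk[of b "translator y" y]]
      by blast+
    show ?thesis
      by (rule homotopic_join[OF homotopic_refl homotopic_join[OF M R m(2,3)] m(1) walk_join[OF m(2,3)]])
  qed
  ultimately show ?thesis by (simp add: a_b_k_def)
qed

text \<open>
  Passing from a path to a word and back returns the path up to homotopy, once the ends of both are
  joined to translates of the base point.
\<close>
lemma word_path_path_word:
  assumes "walk \<Gamma> x p y"
  shows "homotopic \<Gamma> (spoke_to x \<Zcomp> p)
    (map (translator x) (word_path (path_word p)) \<Zcomp> spoke_to y)"
  using assms
proof (induction rule: walk_induct)
  case (single x)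
  then show ?case
    using walk_not_Nil[OF spoke_walk[of "rep x"]] spoke_to_walk[of x]
    by (simp add: singleton_join walk_def homotopic_refl)
next
  case (edge x y p z)
  note xy = edge.hyps(2-4)
  have z: "z \<in> elts \<Gamma>" using walk_elts[OF edge.hyps(1)] by simp
  let ?u = "edge_word x y" and ?v = "path_word p"
  have w: "is_word ?u" "is_word ?v"
    using edge_is_word[OF xy] path_is_word[OF edge.hyps(1)] by auto
  have el: "set (word_path ?v) \<subseteq> elts \<Gamma>" and ne: "word_path ?v \<noteq> []"
    using word_path_walk[OF w(2)] by (auto simp: walk_def path_def)
  have u: "walk \<Gamma> (translator x w0) (map (translator x) (word_path ?u)) (translator y w0)"
    using walk_map[OF _ word_path_walk[OF w(1)], of "translator x"] xy base
    by (simp add: realize_edge_word)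
  have v: "walk \<Gamma> (translator y w0) (map (translator y) (word_path ?v)) (translator z w0)"
    using walk_map[OF _ word_path_walk[OF w(2)], of "translator y"] xy z base
    by (simp add: realize_path_word[OF edge.hyps(1)])
  have "homotopic \<Gamma> (spoke_to x \<Zcomp> [x, y] \<Zcomp> p)
      ((map (translator x) (word_path ?u) \<Zcomp> spoke_to y) \<Zcomp> p)"
    using homotopic_join[OF homotopic_sym[OF word_path_edge_word[OF xy]] homotopic_refl
        walk_join[OF spoke_to_walk walk_edge] edge.hyps(1)] xy
    by (simp add: join_assoc)
  also have "(map (translator x) (word_path ?u) \<Zcomp> spoke_to y) \<Zcomp> p =
      map (translator x) (word_path ?u) \<Zcomp> (spoke_to y \<Zcomp> p)"
    using walk_not_Nil[OF spoke_to_walk[OF xy(2)]] by (rule join_assoc)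
  finally have 1: "homotopic \<Gamma> (spoke_to x \<Zcomp> [x, y] \<Zcomp> p) \<dots>" .
  have 2: "homotopic \<Gamma> \<dots> (map (translator x) (word_path ?u) \<Zcomp>
      (map (translator y) (word_path ?v) \<Zcomp> spoke_to z))"
    using homotopic_join[OF homotopic_refl edge.IH u walk_join[OF spoke_to_walk edge.hyps(1)]] xy by blast
  have "map (translator x) (word_path (?u @ ?v)) =
      map (translator x) (word_path ?u) \<Zcomp> map (translator y) (word_path ?v)"
    using el xy w by (auto simp: word_path_append map_join realize_edge_word subset_iff intro!: arg_cong2[where f = join])
  then have "map (translator x) (word_path (path_word ([x, y] \<Zcomp> p))) \<Zcomp> spoke_to z =
      map (translator x) (word_path ?u) \<Zcomp> (map (translator y) (word_path ?v) \<Zcomp> spoke_to z)"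
    using ne by (simp add: path_word_edge[OF edge.hyps(1)] join_assoc)
  then show ?case using homotopic_trans[OF 1 2] by simp
qed

lemma holonomy_lasso:
  assumes a: "a \<in> W" and g: "g \<in> stab {a}"
  shows "holonomy (lasso a g) =
    letter a g \<otimes>\<^bsub>completion\<^esub> letter w0 (inv g \<otimes> translator (g w0))"
proof -
  have g': "g \<in> carrier G" "g a = a" using stabD(1)[OF g] stabD(2)[OF g, of a] by simp_all
  have st: "inv g \<otimes> translator (g w0) \<in> stab {w0}"
    using connecting_stab[of w0 g "translator (g w0)"] translator[of "g w0"] g' base by simp
  have "holonomy (map g (rev (spoke a))) =
      letter a g \<otimes>\<^bsub>completion\<^esub> letter w0 (inv g \<otimes> translator (g w0))"
    using holonomy_map[OF g'(1) walk_rev[OF spoke_walk[OF a]]]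
      holonomy_W[OF walk_rev[OF spoke_walk[OF a]]] spoke_subset[OF a] a base g g'
    by simp
  then show ?thesis
    unfolding lasso_def
    using holonomy_join[OF spoke_walk[OF a] spoke_map_rev_walk[OF a g']] a g g' st base
      holonomy_W[OF spoke_walk spoke_subset, of a] by simp
qed

text \<open>
  In the other direction, passing from a word to a path and back returns the same element of the
  completion.  The extra letter measures how the group element denoted by the word differs from the
  chosen translator of the end of its path; it is trivial when that group element is the identity.
\<close>
lemma holonomy_word_path:
  assumes "is_word u"
  shows "holonomy (word_path u) =
    word_class u \<otimes>\<^bsub>completion\<^esub> letter w0 (inv (realize u) \<otimes> translator (realize u w0))"
  using assms
proof (induction u rule: word_path.induct)
  case 1
  then show ?case using base by (simp add: word_class_Nil letter_one)
next
  case (2 U h b u)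
  define g where "g = (if b then h else inv h)"
  let ?a = "SOME a. a \<in> U" and ?f = "realize u"
  have gen: "(U, h) \<in> gens" and u: "is_word u" using 2(2) by auto
  note f = foot(2)[OF gen] foot(3)[OF gen, of b, folded g_def]
  have g: "g \<in> carrier G" "?f \<in> carrier G" using stabD(1)[OF f(2)] u by auto
  define A B C where "A = inv g \<otimes> translator (g w0)" "B = inv (translator (g w0)) \<otimes> g"
    "C = inv ?f \<otimes> translator (?f w0)"
  define D where "D = inv (translator (?f w0)) \<otimes> inv g \<otimes> translator (g (?f w0))"
  have st: "A \<in> stab {w0}" "B \<in> stab {w0}" "C \<in> stab {w0}" "D \<in> stab {w0}"
    using connecting_stab[of w0 g "translator (g w0)"] connecting_stab[of w0 "translator (g w0)" g]
      connecting_stab[of w0 ?f "translator (?f w0)"]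
      connecting_stab[of w0 "g \<otimes> translator (?f w0)" "translator (g (?f w0))"]
      translator[of "g w0"] translator[of "?f w0"] translator[of "g (?f w0)"] g base
    by (simp_all add: A_B_C_def D_def inv_mult_group m_assoc)
  have AB: "letter w0 A \<otimes>\<^bsub>completion\<^esub> (letter w0 B \<otimes>\<^bsub>completion\<^esub> c) = c"
    if "c \<in> carrier completion" for c
  proof -
    have "A \<otimes> B = \<one>" using g base by (simp add: A_B_C_def m_assoc)
    then have "letter w0 A \<otimes>\<^bsub>completion\<^esub> letter w0 B = \<one>\<^bsub>completion\<^esub>"
      using letter_mult st base letter_one by simp
    then show ?thesis using that st base by (simp add: completion.m_assoc[symmetric])
  qed
  have CD: "letter w0 C \<otimes>\<^bsub>completion\<^esub> letter w0 D = letter w0 (inv (g \<otimes> ?f) \<otimes> translator (g (?f w0)))"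
  proof -
    have "C \<otimes> D = inv (g \<otimes> ?f) \<otimes> translator (g (?f w0))"
      using g base by (simp add: A_B_C_def D_def m_assoc inv_mult_group)
    then show ?thesis using letter_mult st base by simp
  qed
  have r: "realize (((U, h), b) # u) = g \<otimes> ?f" by (simp add: g_def)
  have word: "word_class (((U, h), b) # u) = letter ?a g \<otimes>\<^bsub>completion\<^esub> word_class u"
  proof -
    have "word_class [((U, h), b)] = letter ?a g"
      using generator_eq_letter[OF gen foot(1)[OF gen]] generator_inverse[OF gen foot(1)[OF gen]]
      by (auto simp: g_def)
    then show ?thesis
      using word_class_append[of "[((U, h), b)]" u] gen u by simp
  qed
  have "holonomy (word_path (((U, h), b) # u)) =
      holonomy (lasso ?a g) \<otimes>\<^bsub>completion\<^esub> holonomy (map g (word_path u))"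
    using holonomy_join[OF lasso_walk[OF f] walk_map[OF g(1) word_path_walk[OF u]]]
    by (simp add: g_def Let_def)
  also have "holonomy (map g (word_path u)) =
      letter w0 B \<otimes>\<^bsub>completion\<^esub> holonomy (word_path u) \<otimes>\<^bsub>completion\<^esub> letter w0 D"
    using holonomy_map[OF g(1) word_path_walk[OF u]] g base by (simp add: A_B_C_def D_def)
  also have "holonomy (word_path u) = word_class u \<otimes>\<^bsub>completion\<^esub> letter w0 C"
    using 2(1)[OF g_def u] by (simp add: A_B_C_def(3))
  also have "holonomy (lasso ?a g) = letter ?a g \<otimes>\<^bsub>completion\<^esub> letter w0 A"
    using holonomy_lasso[OF f] by (simp add: A_B_C_def(1))
  also have "letter ?a g \<otimes>\<^bsub>completion\<^esub> letter w0 A \<otimes>\<^bsub>completion\<^esub>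
      (letter w0 B \<otimes>\<^bsub>completion\<^esub> (word_class u \<otimes>\<^bsub>completion\<^esub> letter w0 C) \<otimes>\<^bsub>completion\<^esub> letter w0 D) =
      letter ?a g \<otimes>\<^bsub>completion\<^esub> word_class u \<otimes>\<^bsub>completion\<^esub> (letter w0 C \<otimes>\<^bsub>completion\<^esub> letter w0 D)"
    using st f u base by (simp add: completion.m_assoc AB)
  finally show ?case
    using r g base unfolding word CD by simp
qed

end


section \<open>The criterion for strict fundamental domains\<close>

lemma trivial_fundamental_group_iff:
  assumes "pregeometry I \<Gamma>" "x \<in> elts \<Gamma>"
  shows "trivial_group (fundamental_group \<Gamma> x) \<longleftrightarrow> (\<forall>p. walk \<Gamma> x p x \<longrightarrow> homotopic \<Gamma> p [x])"
proof -
  have "homotopy_class \<Gamma> p = homotopy_class \<Gamma> [x] \<longleftrightarrow> homotopic \<Gamma> p [x]" for p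
    using homotopy_class_eq[of \<Gamma> p "[x]"] homotopic_refl[of \<Gamma> "[x]"]
    by (auto simp: homotopy_class_def)
  moreover have "cycle_at \<Gamma> x [x]"
    using walk_singleton[OF assms(2)] by (simp add: walk_def cycle_at_def)
  ultimately show ?thesis
    using group_fundamental_group[OF assms]
    by (auto simp: trivial_group_def fundamental_group_def cycle_at_def walk_def)
qed

context strict_fundamental_domain
begin

lemma canonical_map_hom: "canonical_map G \<in> hom completion G"
  by (rule canonical_map_universal_completion(1)[OF is_group])

text \<open>
  A path from the base point to its image under \<open>g\<close> provides a word that denotes \<open>g\<close> up to an
  element fixing the base point.
\<close>
lemma canonical_map_surj:
  assumes conn: "connected_geom \<Gamma>"
  shows "canonical_map G ` carrier completion = carrier G"
proof
  show "canonical_map G ` carrier completion \<subseteq> carrier G"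
    using canonical_map_hom by (auto simp: hom_def)
  show "carrier G \<subseteq> canonical_map G ` carrier completion"
  proof
    fix g assume g: "g \<in> carrier G"
    then obtain p where p: "walk \<Gamma> w0 p (g w0)"
      using conn base unfolding connected_geom_def walk_def by (metis W_elts act_closed)
    let ?t = "translator (g w0)"
    have t: "?t \<in> carrier G" "?t w0 = g w0"
      using translator[of "g w0"] g base by simp_all
    have "inv ?t \<otimes> g \<in> stab {w0}"
      using connecting_stab[of w0 ?t g] t g base by simp
    then have w: "is_word [(({w0}, inv ?t \<otimes> g), True)]"
      by (rule letter_word[OF base])
    (* path_word p denotes ?t, which agrees with g on the base point *)
    define u where "u = path_word p @ [(({w0}, inv ?t \<otimes> g), True)]"
    have "is_word u" using path_is_word[OF p] w by (simp add: u_def)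
    moreover have "realize u = g"
      using realize_append[OF path_is_word[OF p] w] realize_path_word[OF p] g t base
      by (simp add: u_def)
    ultimately show "g \<in> canonical_map G ` carrier completion"
      using canonical_map_word_class word_class_closed by (metis imageI)
  qed
qed

text \<open>
  A word in the kernel of the canonical map has a closed path; if that path is null-homotopic then
  its holonomy, which is the class of the word, is trivial.  Conversely the holonomy of a closed path
  lies in the kernel; if it is trivial then the word of the path is equivalent to the empty word, so
  the path is homotopic to a constant one.
\<close>
theorem simply_connected_iff_canonical_map_iso:
  assumes pregeom: "pregeometry I \<Gamma>" and conn: "connected_geom \<Gamma>"
  shows "simply_connected \<Gamma> \<longleftrightarrow> canonical_map G \<in> iso completion G"
proof -
  interpret hom: group_hom completion G "canonical_map G"
    by (unfold_locales) (rule canonical_map_hom)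
  have "simply_connected \<Gamma> \<longleftrightarrow> (\<forall>x\<in>elts \<Gamma>. \<forall>p. walk \<Gamma> x p x \<longrightarrow> homotopic \<Gamma> p [x])"
    using trivial_fundamental_group_iff[OF pregeom] conn by (simp add: simply_connected_def)
  also have "\<dots> \<longleftrightarrow> inj_on (canonical_map G) (carrier completion)"
  proof
    assume sc: "\<forall>x\<in>elts \<Gamma>. \<forall>p. walk \<Gamma> x p x \<longrightarrow> homotopic \<Gamma> p [x]"
    show "inj_on (canonical_map G) (carrier completion)"
      unfolding hom.inj_on_one_iff
    proof (intro allI impI)
      fix c assume "c \<in> carrier completion" and one: "canonical_map G c = \<one>"
      then obtain u where u: "is_word u" "c = word_class u"
        by (auto elim: completion_elt)
      then have r: "realize u = \<one>" using one canonical_map_word_class by simp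
      then have "walk \<Gamma> w0 (word_path u) w0" using word_path_walk[OF u(1)] base by simp
      then have "homotopic \<Gamma> (word_path u) [w0]" using sc base by simp
      then have "holonomy (word_path u) = \<one>\<^bsub>completion\<^esub>"
        using holonomy_homotopic[of "word_path u" "[w0]"] by (simp add: word_class_Nil)
      then show "c = \<one>\<^bsub>completion\<^esub>"
        using holonomy_word_path[OF u(1)] r u base by (simp add: letter_one)
    qed
  next
    assume inj: "inj_on (canonical_map G) (carrier completion)"
    show "\<forall>x\<in>elts \<Gamma>. \<forall>p. walk \<Gamma> x p x \<longrightarrow> homotopic \<Gamma> p [x]"
    proof (intro ballI allI impI)
      fix x p assume x: "x \<in> elts \<Gamma>" and p: "walk \<Gamma> x p x"
      note w = path_is_word[OF p]
      have "canonical_map G (word_class (path_word p)) = \<one>"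
        using canonical_map_word_class[OF w] realize_path_word[OF p] x by simp
      then have "word_class (path_word p) = word_class []"
        using inj[unfolded hom.inj_on_one_iff] w by (simp add: word_class_Nil)
      then have "pres_eq gens rels (path_word p) []"
        using word_class_eq_iff[OF w, of "[]"] by simp
      then have 1: "homotopic \<Gamma> (map (translator x) (word_path (path_word p))) [translator x w0]"
        using homotopic_map[OF translator(1)[OF x] word_path_pres_eq] by fastforce
      have w': "walk \<Gamma> (translator x w0) (map (translator x) (word_path (path_word p))) (translator x w0)"
        using walk_map[OF _ word_path_walk[OF w], of "translator x"] realize_path_word[OF p] x base
        by simp
      have "homotopic \<Gamma> (map (translator x) (word_path (path_word p)) \<Zcomp> spoke_to x)
          ([translator x w0] \<Zcomp> spoke_to x)"
        by (rule homotopic_join[OF 1 homotopic_refl w' spoke_to_walk[OF x]])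
      moreover have "[translator x w0] \<Zcomp> spoke_to x = spoke_to x"
        using spoke_to_walk[OF x] by (simp add: singleton_join walk_def path_def)
      ultimately have "homotopic \<Gamma> (spoke_to x \<Zcomp> p) (spoke_to x \<Zcomp> [x])"
        using homotopic_trans[OF word_path_path_word[OF p]] by simp
      then show "homotopic \<Gamma> p [x]"
        by (rule homotopic_cancel_left[OF spoke_to_walk[OF x] p walk_singleton[OF x]])
    qed
  qed
  also have "\<dots> \<longleftrightarrow> canonical_map G \<in> iso completion G"
    using canonical_map_hom canonical_map_surj[OF conn] by (auto simp: iso_def bij_betw_def)
  finally show ?thesis .
qed

end


section \<open>Halls of rank at least three\<close>

context incidence_structure
begin

text \<open>
  Both paths cross the square \<open>(x, m, z, m')\<close>, which the diagonal \<open>(m, m')\<close> cuts into two triangles.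
\<close>
lemma change_middle:
  assumes "x \<in> elts \<Gamma>" "m \<in> elts \<Gamma>" "m' \<in> elts \<Gamma>" "z \<in> elts \<Gamma>"
    and "inc \<Gamma> x m" "inc \<Gamma> m z" "inc \<Gamma> x m'" "inc \<Gamma> m' z" "inc \<Gamma> m m'"
  shows "homotopic \<Gamma> ([x, m] \<Zcomp> [m, z]) ([x, m'] \<Zcomp> [m', z])"
proof -
  have m'm: "inc \<Gamma> m' m" using assms inc_sym by blast
  note e = walk_edge[OF assms(1,3,7)] walk_edge[OF assms(3,2) m'm] walk_edge[OF assms(2,4,6)]
  have "homotopic \<Gamma> ([x, m] \<Zcomp> [m, z]) (([x, m'] \<Zcomp> [m', m]) \<Zcomp> [m, z])"
    by (rule homotopic_join[OF homotopic_sym[OF triangle_homotopic] homotopic_refl walk_edge walk_edge])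
      (use assms m'm in auto)
  also have "([x, m'] \<Zcomp> [m', m]) \<Zcomp> [m, z] = [x, m'] \<Zcomp> ([m', m] \<Zcomp> [m, z])"
    by (simp add: join_assoc)
  finally have 1: "homotopic \<Gamma> ([x, m] \<Zcomp> [m, z]) \<dots>" .
  have "homotopic \<Gamma> \<dots> ([x, m'] \<Zcomp> [m', z])"
    by (rule homotopic_join[OF homotopic_refl triangle_homotopic e(1) walk_join[OF e(2,3)]])
      (use assms m'm in auto)
  with 1 show ?thesis by (rule homotopic_trans)
qed

text \<open>
  Fix the end \<open>z\<close>.  Every walk to \<open>z\<close> contracts to a standard one from the same starting point: the
  edge to \<open>z\<close>, or, from another element of the type of \<open>z\<close>, the detour through a fixed \<open>v\<close> of a
  different type.  For an edge from \<open>x\<close> into such a detour, \<open>v\<close> is first exchanged for an element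
  whose type also differs from that of \<open>x\<close>; this is where three types are needed.
\<close>
lemma multipartite_walks_homotopic:
  assumes W: "W \<subseteq> elts \<Gamma>"
    and inc: "\<And>a b. a \<in> W \<Longrightarrow> b \<in> W \<Longrightarrow> inc \<Gamma> a b \<longleftrightarrow> a = b \<or> tp \<Gamma> a \<noteq> tp \<Gamma> b"
    and third: "\<And>i j. \<exists>u\<in>W. tp \<Gamma> u \<noteq> i \<and> tp \<Gamma> u \<noteq> j"
    and "walk \<Gamma> a p z" "walk \<Gamma> a q z" "set p \<subseteq> W" "set q \<subseteq> W"
  shows "homotopic \<Gamma> p q"
proof -
  have E: "a \<in> elts \<Gamma>" if "a \<in> W" for a using that W by blast
  have z: "z \<in> W" using assms(4,6) by (auto simp: walk_def path_def)
  obtain v where v: "v \<in> W" "tp \<Gamma> v \<noteq> tp \<Gamma> z" using third by blast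
  have middle: "homotopic \<Gamma> ([x, m] \<Zcomp> [m, z]) ([x, m'] \<Zcomp> [m', z])"
    if "x \<in> W" "m \<in> W" "m' \<in> W" "tp \<Gamma> x = tp \<Gamma> z" "tp \<Gamma> m \<noteq> tp \<Gamma> z" "tp \<Gamma> m' \<noteq> tp \<Gamma> z" for x m m'
  proof -
    obtain u where u: "u \<in> W" "tp \<Gamma> u \<noteq> tp \<Gamma> z" "tp \<Gamma> u \<noteq> tp \<Gamma> m" using third by blast
    have *: "homotopic \<Gamma> ([x, n] \<Zcomp> [n, z]) ([x, n'] \<Zcomp> [n', z])"
      if "n \<in> W" "n' \<in> W" "tp \<Gamma> n \<noteq> tp \<Gamma> z" "tp \<Gamma> n' \<noteq> tp \<Gamma> z" "tp \<Gamma> n \<noteq> tp \<Gamma> n'" for n n'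
      using that \<open>x \<in> W\<close> \<open>tp \<Gamma> x = tp \<Gamma> z\<close> z E
      by (intro change_middle) (auto simp: inc)
    show ?thesis
    proof (cases "tp \<Gamma> m = tp \<Gamma> m'")
      case True
      then show ?thesis
        using homotopic_trans[OF *[of m u] *[of u m']] that u by simp
    qed (use * that in simp)
  qed
  (* the standard walk from x to z *)
  define s where "s x = (if x = z then [z] else if tp \<Gamma> x \<noteq> tp \<Gamma> z then [x, z] else [x, v] \<Zcomp> [v, z])" for x
  have s_walk: "walk \<Gamma> x (s x) z" if "x \<in> W" for x
    unfolding s_def using that z v E
    by (auto simp: inc intro!: walk_singleton walk_edge walk_join[of _ x _ v])
  have step: "homotopic \<Gamma> ([x, y] \<Zcomp> s y) (s x)" if xy: "x \<in> W" "y \<in> W" "inc \<Gamma> x y" for x y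
  proof -
    have triangle: "homotopic \<Gamma> ([a, b] \<Zcomp> [b, c]) [a, c]"
      if "a \<in> W" "b \<in> W" "c \<in> W" "inc \<Gamma> a b" "inc \<Gamma> b c" "inc \<Gamma> a c" for a b c
      using that E by (intro triangle_homotopic)
    consider "x = y" | "y = z" "x \<noteq> y" | "tp \<Gamma> y \<noteq> tp \<Gamma> z" "x = z"
      | "tp \<Gamma> y \<noteq> tp \<Gamma> z" "tp \<Gamma> x \<noteq> tp \<Gamma> z" "x \<noteq> y"
      | "tp \<Gamma> y \<noteq> tp \<Gamma> z" "tp \<Gamma> x = tp \<Gamma> z" "x \<noteq> z"
      | "tp \<Gamma> y = tp \<Gamma> z" "y \<noteq> z" "x \<noteq> y"
      by blast
    then show ?thesis
    proof cases
      case 1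
      have "homotopic \<Gamma> ([x, x] \<Zcomp> s x) ([x] \<Zcomp> s x)"
        using homotopic_join[OF loop_homotopic homotopic_refl walk_edge s_walk] E inc_refl xy by blast
      then show ?thesis
        using s_walk[of x] xy 1 by (simp add: singleton_join walk_def path_def)
    next
      case 2
      then show ?thesis using xy by (simp add: s_def homotopic_refl inc)
    next
      case 3
      then have "homotopic \<Gamma> ([z, y] \<Zcomp> [y, z]) [z, z]"
        using triangle[of z y z] xy by (auto simp: inc)
      then show ?thesis
        using 3 homotopic_trans loop_homotopic[OF E[OF z]] by (auto simp: s_def)
    next
      case 4
      then show ?thesis using triangle[of x y z] xy z by (auto simp: s_def inc)
    next
      case 5
      then show ?thesis using middle[of x y v] xy v by (auto simp: s_def)
    next
      case 6
      then have x: "tp \<Gamma> x \<noteq> tp \<Gamma> z" using xy by (auto simp: inc)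
      obtain u where u: "u \<in> W" "tp \<Gamma> u \<noteq> tp \<Gamma> z" "tp \<Gamma> u \<noteq> tp \<Gamma> x" using third by blast
      have i: "inc \<Gamma> y v" "inc \<Gamma> v z" "inc \<Gamma> y u" "inc \<Gamma> u z" "inc \<Gamma> x u" "inc \<Gamma> x z"
        using 6 x u v xy z by (auto simp: inc)
      note e = walk_edge[OF E[OF xy(1)] E[OF xy(2)] xy(3)]
        walk_join[OF walk_edge[OF E E i(1)] walk_edge[OF E E i(2)], OF xy(2) v(1) v(1) z]
      have "homotopic \<Gamma> ([x, y] \<Zcomp> ([y, v] \<Zcomp> [v, z])) ([x, y] \<Zcomp> ([y, u] \<Zcomp> [u, z]))"
        using homotopic_join[OF homotopic_refl middle e] 6 u v xy by blast
      also have "[x, y] \<Zcomp> ([y, u] \<Zcomp> [u, z]) = ([x, y] \<Zcomp> [y, u]) \<Zcomp> [u, z]"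
        by (simp add: join_assoc)
      finally have 1: "homotopic \<Gamma> ([x, y] \<Zcomp> ([y, v] \<Zcomp> [v, z])) \<dots>" .
      have "homotopic \<Gamma> (([x, y] \<Zcomp> [y, u]) \<Zcomp> [u, z]) ([x, u] \<Zcomp> [u, z])"
        using homotopic_join[OF triangle homotopic_refl walk_join[OF e(1) walk_edge] walk_edge]
          xy u z i E by blast
      moreover have "homotopic \<Gamma> ([x, u] \<Zcomp> [u, z]) [x, z]"
        using triangle xy u z i by blast
      ultimately have "homotopic \<Gamma> ([x, y] \<Zcomp> ([y, v] \<Zcomp> [v, z])) [x, z]"
        using 1 homotopic_trans by blast
      then show ?thesis using 6 x by (auto simp: s_def)
    qed
  qed
  have "homotopic \<Gamma> r (s x)" if "walk \<Gamma> x r z'" "set r \<subseteq> W" "z' = z" for x r z'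
    using that
  proof (induction rule: walk_induct)
    case (single x)
    then show ?case by (simp add: s_def homotopic_refl)
  next
    case (edge x y p z')
    have "x \<in> W" "y \<in> W" "set p \<subseteq> W"
      using edge.prems edge.hyps(1) by (cases p; auto simp: join_def walk_def path_def)+
    then have "homotopic \<Gamma> p (s y)" using edge.IH edge.prems by blast
    then have "homotopic \<Gamma> ([x, y] \<Zcomp> p) ([x, y] \<Zcomp> s y)"
      by (rule homotopic_join[OF homotopic_refl _ walk_edge[OF edge.hyps(2-4)] edge.hyps(1)])
    then show ?case
      using step[OF \<open>x \<in> W\<close> \<open>y \<in> W\<close> edge.hyps(4)] by (rule homotopic_trans)
  qed
  note to_s = this
  show ?thesis
    using homotopic_trans[OF to_s[OF assms(4,6)] homotopic_sym[OF to_s[OF assms(5,7)]]] by simp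
qed

lemma multipartite_connected:
  assumes W: "W \<subseteq> elts \<Gamma>"
    and inc: "\<And>a b. a \<in> W \<Longrightarrow> b \<in> W \<Longrightarrow> inc \<Gamma> a b \<longleftrightarrow> a = b \<or> tp \<Gamma> a \<noteq> tp \<Gamma> b"
    and third: "\<And>i j. \<exists>u\<in>W. tp \<Gamma> u \<noteq> i \<and> tp \<Gamma> u \<noteq> j"
    and ab: "a \<in> W" "b \<in> W"
  shows "\<exists>p. walk \<Gamma> a p b \<and> set p \<subseteq> W"
proof -
  obtain u where u: "u \<in> W" "tp \<Gamma> u \<noteq> tp \<Gamma> a" "tp \<Gamma> u \<noteq> tp \<Gamma> b" using third by blast
  then have "walk \<Gamma> a ([a, u] \<Zcomp> [u, b]) b"
    using ab W by (intro walk_join[of _ a _ u] walk_edge) (auto simp: inc)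
  then show ?thesis using ab u by (intro exI[of _ "[a, u] \<Zcomp> [u, b]"]) (simp add: join_def)
qed

end


section \<open>Orbit representatives forming a hall\<close>

locale hall_of_representatives =
  fixes \<Gamma> :: "('x, 'i) pregeom" and I :: "'i set"
    and H :: "('x \<Rightarrow> 'x) set" and G :: "('x \<Rightarrow> 'x) monoid"
    and t :: "'i \<Rightarrow> nat" and w :: "'i \<Rightarrow> nat \<Rightarrow> 'x" and W :: "'x set"
  assumes pregeom: "pregeometry I \<Gamma>" and rank: "infinite I \<or> card I \<ge> 3"
    and H: "subgroup H (Aut \<Gamma>)" and G: "G = (Aut \<Gamma>)\<lparr>carrier := H\<rparr>"
    and reps: "\<forall>i \<in> I. orbit_representatives \<Gamma> G i (t i) (w i)"
    and W: "W = (\<Union>i \<in> I. w i ` {1..t i})"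
    and hall: "hall I \<Gamma> W"
    and transitive: "\<forall>V. V \<subseteq> W \<and> chamber I \<Gamma> V \<longrightarrow>
           incidence_transitive G (orbit_pregeometry \<Gamma> G V) \<and>
           pennant_transitive G (orbit_pregeometry \<Gamma> G V)"
begin

lemma G_Aut: "carrier G \<subseteq> carrier (Aut \<Gamma>)"
  using subgroup.subset[OF H] by (simp add: G)

lemma act_closed: "g \<in> carrier G \<Longrightarrow> x \<in> elts \<Gamma> \<Longrightarrow> g x \<in> elts \<Gamma>"
  using G_Aut by (auto simp: Aut_def Bij_def intro: bij_betwE[THEN bspec])

lemma act_tp: "g \<in> carrier G \<Longrightarrow> x \<in> elts \<Gamma> \<Longrightarrow> tp \<Gamma> (g x) = tp \<Gamma> x"
  using G_Aut by (auto simp: Aut_def)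

lemma act_inc:
  "g \<in> carrier G \<Longrightarrow> x \<in> elts \<Gamma> \<Longrightarrow> y \<in> elts \<Gamma> \<Longrightarrow> inc \<Gamma> x y \<Longrightarrow> inc \<Gamma> (g x) (g y)"
  using G_Aut by (auto simp: Aut_def)

lemma act_one: "x \<in> elts \<Gamma> \<Longrightarrow> \<one>\<^bsub>G\<^esub> x = x"
  by (simp add: G Aut_def BijGroup_def)

lemma act_mult:
  "g \<in> carrier G \<Longrightarrow> h \<in> carrier G \<Longrightarrow> x \<in> elts \<Gamma> \<Longrightarrow> (g \<otimes>\<^bsub>G\<^esub> h) x = g (h x)"
  using G_Aut by (auto simp: G Aut_def BijGroup_def compose_eq subset_iff)

lemma W_subset: "W \<subseteq> elts \<Gamma>" and W_types: "tp \<Gamma> ` W = I"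
  using hall by (auto simp: hall_def)

lemma W_inc:
  assumes "a \<in> W" "b \<in> W" shows "inc \<Gamma> a b \<longleftrightarrow> a = b \<or> tp \<Gamma> a \<noteq> tp \<Gamma> b"
proof
  show "inc \<Gamma> a b \<Longrightarrow> a = b \<or> tp \<Gamma> a \<noteq> tp \<Gamma> b"
    using assms W_subset pregeom unfolding pregeometry_def by blast
  assume "a = b \<or> tp \<Gamma> a \<noteq> tp \<Gamma> b"
  then have "flag \<Gamma> {a, b}"
    using hall assms unfolding hall_def inj_on_def by auto
  then show "inc \<Gamma> a b" by (simp add: flag_def)
qed

lemma W_third_type: "\<exists>u\<in>W. tp \<Gamma> u \<noteq> i \<and> tp \<Gamma> u \<noteq> j"
proof -
  have "\<not> I \<subseteq> {i, j}"
  proof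
    assume I: "I \<subseteq> {i, j}"
    then have "finite I" by (rule finite_subset) simp
    moreover have "card I \<le> 2"
      using card_mono[OF _ I] card_insert_le_m1[of 2 "{j}" i] by simp
    ultimately show False using rank by simp
  qed
  then show ?thesis using W_types by auto
qed

lemma orbit_rep:
  assumes "x \<in> elts \<Gamma>" shows "\<exists>a\<in>W. \<exists>g\<in>carrier G. g a = x"
proof -
  have "tp \<Gamma> x \<in> I" using pregeom assms by (auto simp: pregeometry_def)
  then obtain k where k: "k \<in> {1..t (tp \<Gamma> x)}" "x \<in> orbit G (\<lambda>g. g) (w (tp \<Gamma> x) k)"
    using reps assms unfolding orbit_representatives_def by blast
  then have "w (tp \<Gamma> x) k \<in> W"
    using \<open>tp \<Gamma> x \<in> I\<close> unfolding W by blast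
  moreover obtain g where "g \<in> carrier G" "g (w (tp \<Gamma> x) k) = x"
    using k(2) by (auto simp: orbit_def)
  ultimately show ?thesis by blast
qed

lemma orbit_unique:
  assumes "a \<in> W" "g \<in> carrier G" "g a \<in> W" shows "g a = a"
proof -
  obtain i k where i: "i \<in> I" "k \<in> {1..t i}" "a = w i k" using assms(1) unfolding W by blast
  obtain j l where j: "j \<in> I" "l \<in> {1..t j}" "g a = w j l" using assms(3) unfolding W by blast
  have a: "a \<in> elts \<Gamma>" "g a \<in> elts \<Gamma>" using assms W_subset by auto
  have "tp \<Gamma> a = i" "tp \<Gamma> (g a) = j"
    using reps i j unfolding orbit_representatives_def by metis+
  then have ij: "i = j" using act_tp[OF assms(2) a(1)] by simp
  have one: "\<one>\<^bsub>G\<^esub> \<in> carrier G" using subgroup.one_closed[OF H] by (simp add: G)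
  have "g a \<in> orbit G (\<lambda>g. g) (w j k)" using assms(2) i ij by (auto simp: orbit_def)
  moreover have "g a \<in> orbit G (\<lambda>g. g) (w j l)"
    using one act_one[OF a(2)] j by (auto simp: orbit_def intro: exI[of _ "\<one>\<^bsub>G\<^esub>"])
  ultimately have "k = l"
    using reps j i ij a(2) \<open>tp \<Gamma> (g a) = j\<close> unfolding orbit_representatives_def by metis
  then show ?thesis using i j ij by simp
qed

text \<open>
  By the hall property, the representatives of the elements of \<open>F\<close> together with one element of \<open>W\<close>
  for each remaining type form a chamber \<open>V\<close>.  Both \<open>F\<close> and its set of representatives are flags of
  the orbit pregeometry of \<open>V\<close>, so transitivity on flags of cardinality two or three moves one onto
  the other.
\<close>
lemma flag_translate:
  assumes F: "flag \<Gamma> F" and card: "card F \<in> {1, 2, 3}"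
  shows "\<exists>k\<in>carrier G. F \<subseteq> k ` W"
proof -
  have FX: "F \<subseteq> elts \<Gamma>" using F by (simp add: flag_def)
  have inj: "inj_on (tp \<Gamma>) F"
    using F pregeom unfolding flag_def pregeometry_def inj_on_def by blast
  have FI: "tp \<Gamma> ` F \<subseteq> I" using FX pregeom by (auto simp: pregeometry_def)
  obtain \<rho> where \<rho>: "\<And>x. x \<in> F \<Longrightarrow> \<rho> x \<in> W \<and> (\<exists>g\<in>carrier G. g (\<rho> x) = x)"
    using orbit_rep FX by (metis subsetD)
  have \<rho>_tp: "tp \<Gamma> (\<rho> x) = tp \<Gamma> x" if "x \<in> F" for x
  proof -
    obtain g where "g \<in> carrier G" "g (\<rho> x) = x" "\<rho> x \<in> W" using \<rho>[OF \<open>x \<in> F\<close>] by blast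
    then show ?thesis using act_tp[of g "\<rho> x"] W_subset by auto
  qed
  obtain \<tau> where \<tau>: "\<And>i. i \<in> I \<Longrightarrow> \<tau> i \<in> W \<and> tp \<Gamma> (\<tau> i) = i"
  proof -
    have "\<forall>i\<in>I. \<exists>a. a \<in> W \<and> tp \<Gamma> a = i" using W_types by auto
    from bchoice[OF this] show thesis using that by blast
  qed
  define V where "V = \<rho> ` F \<union> \<tau> ` (I - tp \<Gamma> ` F)"
  have VW: "V \<subseteq> W" using \<rho> \<tau> by (auto simp: V_def)
  have "inj_on (tp \<Gamma>) V"
  proof (rule inj_on_inverseI)
    fix v assume "v \<in> V"
    then consider x where "x \<in> F" "v = \<rho> x" | i where "i \<in> I" "i \<notin> tp \<Gamma> ` F" "v = \<tau> i"
      unfolding V_def by blast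
    then show "(if tp \<Gamma> v \<in> tp \<Gamma> ` F then \<rho> (inv_into F (tp \<Gamma>) (tp \<Gamma> v)) else \<tau> (tp \<Gamma> v)) = v"
      by cases (simp_all add: \<rho>_tp inv_into_f_f[OF inj] \<tau>)
  qed
  then have flagV: "flag \<Gamma> V" using hall VW by (simp add: hall_def)
  moreover have "tp \<Gamma> ` V = I"
  proof -
    have 1: "tp \<Gamma> ` \<rho> ` F = tp \<Gamma> ` F"
      unfolding image_image by (rule image_cong[OF HOL.refl \<rho>_tp])
    have 2: "tp \<Gamma> ` \<tau> ` (I - tp \<Gamma> ` F) = (\<lambda>i. i) ` (I - tp \<Gamma> ` F)"
      unfolding image_image by (rule image_cong[OF HOL.refl]) (use \<tau> in blast)
    show ?thesis unfolding V_def image_Un 1 2 using FI by auto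
  qed
  ultimately have chamber: "chamber I \<Gamma> V" by (simp add: chamber_def)
  have one: "\<one>\<^bsub>G\<^esub> \<in> carrier G" using subgroup.one_closed[OF H] by (simp add: G)
  have orb: "x \<in> elts (orbit_pregeometry \<Gamma> G V)" if "v \<in> V" "g \<in> carrier G" "g v = x" for x v g
    using that by (auto simp: orbit_pregeometry_def orbit_def)
  have "F \<subseteq> elts (orbit_pregeometry \<Gamma> G V)"
  proof
    fix x assume "x \<in> F"
    then obtain g where "g \<in> carrier G" "g (\<rho> x) = x" using \<rho> by blast
    then show "x \<in> elts (orbit_pregeometry \<Gamma> G V)"
      using orb[of "\<rho> x" g x] \<open>x \<in> F\<close> by (simp add: V_def)
  qed
  then have 1: "flag (orbit_pregeometry \<Gamma> G V) F"
    using F by (simp add: flag_def orbit_pregeometry_def)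
  have "\<rho> ` F \<subseteq> elts (orbit_pregeometry \<Gamma> G V)"
  proof
    fix v assume "v \<in> \<rho> ` F"
    then have "v \<in> V" by (simp add: V_def)
    then show "v \<in> elts (orbit_pregeometry \<Gamma> G V)"
      using orb[OF _ one act_one] VW W_subset by blast
  qed
  then have 2: "flag (orbit_pregeometry \<Gamma> G V) (\<rho> ` F)"
    using flagV by (simp add: flag_def orbit_pregeometry_def V_def)
  have "inj_on \<rho> F" using \<rho>_tp inj by (metis inj_on_def)
  then have 3: "card (\<rho> ` F) = card F" by (rule card_image)
  have 4: "tp (orbit_pregeometry \<Gamma> G V) ` \<rho> ` F = tp (orbit_pregeometry \<Gamma> G V) ` F"
    using \<rho>_tp by (simp add: orbit_pregeometry_def image_image)
  show ?thesis
  proof (cases "card F = 1")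
    case True
    then obtain x where "F = {x}" by (auto simp: card_1_singleton_iff)
    then obtain g where g: "g \<in> carrier G" "g (\<rho> x) = x" "\<rho> x \<in> W" using \<rho> by blast
    then have "F \<subseteq> g ` W" using \<open>F = {x}\<close> imageI[OF g(3), of g] by simp
    then show ?thesis using g(1) by (rule bexI)
  next
    case False
    then have trans: "flag_transitive (card F) G (orbit_pregeometry \<Gamma> G V)"
      using transitive VW chamber card by auto
    obtain k where k: "k \<in> carrier G" "k ` \<rho> ` F = F"
      using trans[unfolded flag_transitive_def, rule_format, of "\<rho> ` F" F] 1 2 3 4 by metis
    have "\<rho> ` F \<subseteq> W" using \<rho> by blast
    then have "F \<subseteq> k ` W" using k(2) image_mono[of "\<rho> ` F" W k] by simp
    then show ?thesis using k(1) by (rule bexI)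
  qed
qed

lemma strict_fundamental_domain:
  assumes "w0 \<in> W" shows "strict_fundamental_domain \<Gamma> G W w0"
proof -
  interpret incidence_structure \<Gamma>
    using pregeom by unfold_locales (auto simp: pregeometry_def)
  interpret group G
    unfolding G by (rule subgroup.subgroup_is_group[OF H group_Aut])
  show ?thesis
  proof
    fix x y z
    assume x: "x \<in> elts \<Gamma>" "y \<in> elts \<Gamma>" "z \<in> elts \<Gamma>" and i: "inc \<Gamma> x y" "inc \<Gamma> y z" "inc \<Gamma> x z"
    have "flag \<Gamma> {x, y, z}"
      using x i inc_refl inc_sym by (auto simp: flag_def)
    moreover have "card {x, y, z} \<in> {1, 2, 3}" by (auto simp: card_insert_if)
    ultimately obtain k where k: "k \<in> carrier G" "{x, y, z} \<subseteq> k ` W"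
      using flag_translate by blast
    then have "x \<in> k ` W" "y \<in> k ` W" "z \<in> k ` W" by simp_all
    then show "\<exists>k\<in>carrier G. \<exists>a\<in>W. \<exists>b\<in>W. \<exists>c\<in>W. k a = x \<and> k b = y \<and> k c = z"
      using k(1) by (metis imageE)
  next
    fix a assume "a \<in> W"
    then show "\<exists>p. walk \<Gamma> w0 p a \<and> set p \<subseteq> W"
      using multipartite_connected[OF W_subset W_inc W_third_type assms] by blast
  next
    fix a p b q
    assume "walk \<Gamma> a p b" "walk \<Gamma> a q b" "set p \<subseteq> W" "set q \<subseteq> W"
    then show "homotopic \<Gamma> p q"
      using multipartite_walks_homotopic[OF W_subset W_inc W_third_type] by blast
  qed (fact act_closed act_one act_mult act_inc W_subset assms orbit_unique)+
qed

end

theorem corollary3p2: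
  fixes \<Gamma> :: "('x, 'i) pregeom" and I :: "'i set"
    and H :: "('x \<Rightarrow> 'x) set" and G :: "('x \<Rightarrow> 'x) monoid"
    and t :: "'i \<Rightarrow> nat" and w :: "'i \<Rightarrow> nat \<Rightarrow> 'x" and W :: "'x set"
  assumes "geometry I \<Gamma>" and "connected_geom \<Gamma>" and "infinite I \<or> card I \<ge> 3"
    and "subgroup H (Aut \<Gamma>)" and "G = (Aut \<Gamma>)\<lparr>carrier := H\<rparr>"
    and "\<forall>i \<in> I. orbit_representatives \<Gamma> G i (t i) (w i)"
    and "W = (\<Union>i \<in> I. w i ` {1..t i})"
    and "hall I \<Gamma> W"
    and "\<forall>V. V \<subseteq> W \<and> chamber I \<Gamma> V \<longrightarrow>
           incidence_transitive G (orbit_pregeometry \<Gamma> G V) \<and>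
           pennant_transitive G (orbit_pregeometry \<Gamma> G V)"
  shows "simply_connected \<Gamma> \<longleftrightarrow>
           canonical_map G \<in> iso (universal_completion (parabolic_amalgam \<Gamma> G W)) G"
proof -
  have pregeom: "pregeometry I \<Gamma>" using assms(1) by (simp add: geometry_def)
  interpret hall_of_representatives \<Gamma> I H G t w W
    by (rule hall_of_representatives.intro[OF pregeom assms(3-9)])
  obtain w0 where "w0 \<in> W" using W_third_type by blast
  then interpret strict_fundamental_domain \<Gamma> G W w0
    by (rule strict_fundamental_domain)
  show ?thesis
    by (rule simply_connected_iff_canonical_map_iso[OF pregeom assms(2)])
qed

end
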